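(* Let $G$ be an almost linear minimal group. Then, for some prime $p$, either $G$ is elementary abelian of exponent $p$, or $G$ is a finite (direct) sum of Prüfer $p$-groups. In particular, $G$ is a torsion group.
   Context: An infinite first-order structure $M$ is minimal if every subset of $M$ definable in $M$ with parameters is finite or co-finite. A minimal group is a minimal structure which is a group, possibly with additional first-order structure. The generic type of a minimal structure $M$ is the unique non-algebraic type $p\in S_1(M)$; let $\bar M\succ M$ be a monster model and $p(\bar M)$ the set of realizations of $p$ in $\bar M$. For a strict partial order $<$, incomparability is the relation $x\sim y$ iff $\neg(x<y\vee y<x)$. A strict partial order $<$ on $M$, definable with parameters and having infinite chains, is almost linear if $\sim$ is an equivalence relation on $p(\bar M)$. The structure $M$ is almost linear if such an order exists. *)

theory Defs
  imports
    Complex_Main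
    "HOL-Computational_Algebra.Primes"
    "HOL-Algebra.Multiplicative_Group"
    "HOL-Algebra.Product_Groups"
begin

unbundle cardinal_syntax

section \<open>First-order languages, structures and satisfaction\<close>

record ('f, 'r) lang =
  fsyms :: "'f set"
  rsyms :: "'r set"
  farity :: "'f \<Rightarrow> nat"
  rarity :: "'r \<Rightarrow> nat"

record ('f, 'r, 'a) struct =
  univ :: "'a set"
  fint :: "'f \<Rightarrow> 'a list \<Rightarrow> 'a"
  rint :: "'r \<Rightarrow> 'a list \<Rightarrow> bool"

definition is_struct :: "('f, 'r) lang \<Rightarrow> ('f, 'r, 'a) struct \<Rightarrow> bool" where
  "is_struct L M \<longleftrightarrow> univ M \<noteq> {} \<and>
     (\<forall>f\<in>fsyms L. \<forall>xs. set xs \<subseteq> univ M \<and> length xs = farity L f \<longrightarrow> fint M f xs \<in> univ M)"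

text \<open>Parameters are elements of the structure that name themselves.  The formulas over a
  parameter set A are singled out by \<open>is_fm L A\<close> below; \<open>is_fm L {}\<close> gives the plain L-formulas.\<close>

datatype ('f, 'r, 'a) trm = Var nat | Par 'a | App 'f "('f, 'r, 'a) trm list"

datatype ('f, 'r, 'a) fm =
    Eql "('f, 'r, 'a) trm" "('f, 'r, 'a) trm"
  | Atm 'r "('f, 'r, 'a) trm list"
  | Neg "('f, 'r, 'a) fm"
  | Conj "('f, 'r, 'a) fm" "('f, 'r, 'a) fm"
  | Exi nat "('f, 'r, 'a) fm"

fun is_trm :: "('f, 'r) lang \<Rightarrow> 'a set \<Rightarrow> ('f, 'r, 'a) trm \<Rightarrow> bool" where
  "is_trm L A (Var n) \<longleftrightarrow> True"
| "is_trm L A (Par a) \<longleftrightarrow> a \<in> A"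
| "is_trm L A (App f ts) \<longleftrightarrow> f \<in> fsyms L \<and> length ts = farity L f \<and> (\<forall>t\<in>set ts. is_trm L A t)"

fun is_fm :: "('f, 'r) lang \<Rightarrow> 'a set \<Rightarrow> ('f, 'r, 'a) fm \<Rightarrow> bool" where
  "is_fm L A (Eql s t) \<longleftrightarrow> is_trm L A s \<and> is_trm L A t"
| "is_fm L A (Atm r ts) \<longleftrightarrow> r \<in> rsyms L \<and> length ts = rarity L r \<and> (\<forall>t\<in>set ts. is_trm L A t)"
| "is_fm L A (Neg \<phi>) \<longleftrightarrow> is_fm L A \<phi>"
| "is_fm L A (Conj \<phi> \<psi>) \<longleftrightarrow> is_fm L A \<phi> \<and> is_fm L A \<psi>"
| "is_fm L A (Exi n \<phi>) \<longleftrightarrow> is_fm L A \<phi>"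

fun fv_trm :: "('f, 'r, 'a) trm \<Rightarrow> nat set" where
  "fv_trm (Var n) = {n}"
| "fv_trm (Par a) = {}"
| "fv_trm (App f ts) = (\<Union>t\<in>set ts. fv_trm t)"

fun fv :: "('f, 'r, 'a) fm \<Rightarrow> nat set" where
  "fv (Eql s t) = fv_trm s \<union> fv_trm t"
| "fv (Atm r ts) = (\<Union>t\<in>set ts. fv_trm t)"
| "fv (Neg \<phi>) = fv \<phi>"
| "fv (Conj \<phi> \<psi>) = fv \<phi> \<union> fv \<psi>"
| "fv (Exi n \<phi>) = fv \<phi> - {n}"

fun val :: "('f, 'r, 'a) struct \<Rightarrow> (nat \<Rightarrow> 'a) \<Rightarrow> ('f, 'r, 'a) trm \<Rightarrow> 'a" where
  "val M e (Var n) = e n"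
| "val M e (Par a) = a"
| "val M e (App f ts) = fint M f (map (val M e) ts)"

fun sat :: "('f, 'r, 'a) struct \<Rightarrow> (nat \<Rightarrow> 'a) \<Rightarrow> ('f, 'r, 'a) fm \<Rightarrow> bool" where
  "sat M e (Eql s t) \<longleftrightarrow> val M e s = val M e t"
| "sat M e (Atm r ts) \<longleftrightarrow> rint M r (map (val M e) ts)"
| "sat M e (Neg \<phi>) \<longleftrightarrow> \<not> sat M e \<phi>"
| "sat M e (Conj \<phi> \<psi>) \<longleftrightarrow> sat M e \<phi> \<and> sat M e \<psi>"
| "sat M e (Exi n \<phi>) \<longleftrightarrow> (\<exists>a\<in>univ M. sat M (e(n := a)) \<phi>)"

text \<open>Formulas in one variable have their free variables in {0}, formulas in two variables in
  {0, 1}.  In the solution sets below, the values given to all other variables are irrelevant.\<close>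

definition fm1 :: "('f, 'r) lang \<Rightarrow> 'a set \<Rightarrow> ('f, 'r, 'a) fm set" where
  "fm1 L A = {\<phi>. is_fm L A \<phi> \<and> fv \<phi> \<subseteq> {0}}"

definition fm2 :: "('f, 'r) lang \<Rightarrow> 'a set \<Rightarrow> ('f, 'r, 'a) fm set" where
  "fm2 L A = {\<phi>. is_fm L A \<phi> \<and> fv \<phi> \<subseteq> {0, 1}}"

definition solutions :: "('f, 'r, 'a) struct \<Rightarrow> ('f, 'r, 'a) fm \<Rightarrow> 'a set" where
  "solutions M \<phi> = {a \<in> univ M. sat M (\<lambda>_. a) \<phi>}"

definition rel_of :: "('f, 'r, 'a) struct \<Rightarrow> ('f, 'r, 'a) fm \<Rightarrow> 'a \<Rightarrow> 'a \<Rightarrow> bool" where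
  "rel_of M \<phi> x y \<longleftrightarrow> sat M (\<lambda>n. if n = 0 then x else y) \<phi>"


section \<open>Types, elementary extensions and monster models\<close>

text \<open>Consistency with the elementary diagram is expressed as finite satisfiability in M.\<close>

definition complete_types :: "('f, 'r) lang \<Rightarrow> ('f, 'r, 'a) struct \<Rightarrow> 'a set \<Rightarrow> ('f, 'r, 'a) fm set set" where
  "complete_types L M A =
     {p. p \<subseteq> fm1 L A \<and>
         (\<forall>F. finite F \<and> F \<subseteq> p \<longrightarrow> (\<exists>a\<in>univ M. \<forall>\<phi>\<in>F. a \<in> solutions M \<phi>)) \<and>
         (\<forall>\<phi>\<in>fm1 L A. \<phi> \<in> p \<or> Neg \<phi> \<in> p)}"

definition realizations :: "('f, 'r, 'a) struct \<Rightarrow> ('f, 'r, 'a) fm set \<Rightarrow> 'a set" where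
  "realizations N p = {a \<in> univ N. \<forall>\<phi>\<in>p. a \<in> solutions N \<phi>}"

definition algebraic_type :: "('f, 'r, 'a) struct \<Rightarrow> ('f, 'r, 'a) fm set \<Rightarrow> bool" where
  "algebraic_type M p \<longleftrightarrow> (\<exists>\<phi>\<in>p. finite (solutions M \<phi>))"

definition elem_ext :: "('f, 'r) lang \<Rightarrow> ('f, 'r, 'a) struct \<Rightarrow> ('f, 'r, 'a) struct \<Rightarrow> bool" where
  "elem_ext L M N \<longleftrightarrow> is_struct L M \<and> is_struct L N \<and> univ M \<subseteq> univ N \<and>
     (\<forall>\<phi> e. is_fm L {} \<phi> \<and> e ` fv \<phi> \<subseteq> univ M \<longrightarrow> (sat M e \<phi> \<longleftrightarrow> sat N e \<phi>))"

definition saturated :: "('f, 'r) lang \<Rightarrow> 'k rel \<Rightarrow> ('f, 'r, 'a) struct \<Rightarrow> bool" where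
  "saturated L \<kappa> N \<longleftrightarrow>
     (\<forall>A. A \<subseteq> univ N \<and> |A| <o \<kappa> \<longrightarrow> (\<forall>p\<in>complete_types L N A. realizations N p \<noteq> {}))"

definition partial_elementary ::
  "('f, 'r) lang \<Rightarrow> ('f, 'r, 'a) struct \<Rightarrow> 'a set \<Rightarrow> ('a \<Rightarrow> 'a) \<Rightarrow> bool" where
  "partial_elementary L N A h \<longleftrightarrow> A \<subseteq> univ N \<and> h ` A \<subseteq> univ N \<and>
     (\<forall>\<phi> e. is_fm L {} \<phi> \<and> e ` fv \<phi> \<subseteq> A \<longrightarrow> (sat N e \<phi> \<longleftrightarrow> sat N (h \<circ> e) \<phi>))"

definition automorphism :: "('f, 'r) lang \<Rightarrow> ('f, 'r, 'a) struct \<Rightarrow> ('a \<Rightarrow> 'a) \<Rightarrow> bool" where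
  "automorphism L N g \<longleftrightarrow> bij_betw g (univ N) (univ N) \<and>
     (\<forall>f\<in>fsyms L. \<forall>xs. set xs \<subseteq> univ N \<and> length xs = farity L f \<longrightarrow>
        g (fint N f xs) = fint N f (map g xs)) \<and>
     (\<forall>r\<in>rsyms L. \<forall>xs. set xs \<subseteq> univ N \<and> length xs = rarity L r \<longrightarrow>
        (rint N r xs \<longleftrightarrow> rint N r (map g xs)))"

definition strongly_homogeneous :: "('f, 'r) lang \<Rightarrow> 'k rel \<Rightarrow> ('f, 'r, 'a) struct \<Rightarrow> bool" where
  "strongly_homogeneous L \<kappa> N \<longleftrightarrow>
     (\<forall>A h. |A| <o \<kappa> \<and> partial_elementary L N A h \<longrightarrow>
        (\<exists>g. automorphism L N g \<and> (\<forall>a\<in>A. g a = h a)))"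

text \<open>A monster model of M is an elementary extension that is saturated and strongly homogeneous
  for a cardinal exceeding the size of M and of the language.\<close>

definition monster ::
  "('f, 'r) lang \<Rightarrow> 'k rel \<Rightarrow> ('f, 'r, 'a) struct \<Rightarrow> ('f, 'r, 'a) struct \<Rightarrow> bool" where
  "monster L \<kappa> M N \<longleftrightarrow> Card_order \<kappa> \<and> |univ M| <o \<kappa> \<and> |fsyms L| <o \<kappa> \<and> |rsyms L| <o \<kappa> \<and>
     elem_ext L M N \<and> saturated L \<kappa> N \<and> strongly_homogeneous L \<kappa> N"


section \<open>Minimal structures and almost linear orders\<close>

definition minimal_structure :: "('f, 'r) lang \<Rightarrow> ('f, 'r, 'a) struct \<Rightarrow> bool" where
  "minimal_structure L M \<longleftrightarrow> is_struct L M \<and> infinite (univ M) \<and>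
     (\<forall>\<phi>\<in>fm1 L (univ M). finite (solutions M \<phi>) \<or> finite (univ M - solutions M \<phi>))"

text \<open>The multiplication of the group is named by a symbol of the language; inverse and identity
  are definable from it, and the language may contain any further symbols.\<close>

definition minimal_group ::
  "('f, 'r) lang \<Rightarrow> ('f, 'r, 'a) struct \<Rightarrow> ('a, 'm) monoid_scheme \<Rightarrow> bool" where
  "minimal_group L M G \<longleftrightarrow> minimal_structure L M \<and> group G \<and> carrier G = univ M \<and>
     (\<exists>m\<in>fsyms L. farity L m = 2 \<and> (\<forall>x\<in>univ M. \<forall>y\<in>univ M. fint M m [x, y] = x \<otimes>\<^bsub>G\<^esub> y))"

definition generic_type :: "('f, 'r) lang \<Rightarrow> ('f, 'r, 'a) struct \<Rightarrow> ('f, 'r, 'a) fm set" where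
  "generic_type L M = (THE p. p \<in> complete_types L M (univ M) \<and> \<not> algebraic_type M p)"

definition strict_partial_order_on :: "'a set \<Rightarrow> ('a \<Rightarrow> 'a \<Rightarrow> bool) \<Rightarrow> bool" where
  "strict_partial_order_on A R \<longleftrightarrow> (\<forall>x\<in>A. \<not> R x x) \<and>
     (\<forall>x\<in>A. \<forall>y\<in>A. \<forall>z\<in>A. R x y \<and> R y z \<longrightarrow> R x z)"

definition has_infinite_chain :: "'a set \<Rightarrow> ('a \<Rightarrow> 'a \<Rightarrow> bool) \<Rightarrow> bool" where
  "has_infinite_chain A R \<longleftrightarrow>
     (\<exists>C\<subseteq>A. infinite C \<and> (\<forall>x\<in>C. \<forall>y\<in>C. x \<noteq> y \<longrightarrow> R x y \<or> R y x))"

definition incomparability :: "('a \<Rightarrow> 'a \<Rightarrow> bool) \<Rightarrow> 'a \<Rightarrow> 'a \<Rightarrow> bool" where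
  "incomparability R x y \<longleftrightarrow> \<not> (R x y \<or> R y x)"

text \<open>The order is given by a formula over M, so that it can be read both in M and in the
  monster model N.\<close>

definition almost_linear_order ::
  "('f, 'r) lang \<Rightarrow> ('f, 'r, 'a) struct \<Rightarrow> ('f, 'r, 'a) struct \<Rightarrow> ('f, 'r, 'a) fm \<Rightarrow> bool" where
  "almost_linear_order L M N \<phi> \<longleftrightarrow> \<phi> \<in> fm2 L (univ M) \<and>
     strict_partial_order_on (univ M) (rel_of M \<phi>) \<and>
     has_infinite_chain (univ M) (rel_of M \<phi>) \<and>
     (let P = realizations N (generic_type L M)
      in equiv P {(x, y) \<in> P \<times> P. incomparability (rel_of N \<phi>) x y})"

definition almost_linear ::
  "('f, 'r) lang \<Rightarrow> ('f, 'r, 'a) struct \<Rightarrow> ('f, 'r, 'a) struct \<Rightarrow> bool" where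
  "almost_linear L M N \<longleftrightarrow> (\<exists>\<phi>. almost_linear_order L M N \<phi>)"


section \<open>The groups in the conclusion\<close>

definition elementary_abelian :: "nat \<Rightarrow> ('a, 'm) monoid_scheme \<Rightarrow> bool" where
  "elementary_abelian p G \<longleftrightarrow> comm_group G \<and> carrier G \<noteq> {\<one>\<^bsub>G\<^esub>} \<and>
     (\<forall>x\<in>carrier G. x \<noteq> \<one>\<^bsub>G\<^esub> \<longrightarrow> group.ord G x = p)"

definition prufer_group :: "nat \<Rightarrow> complex monoid" where
  "prufer_group p = \<lparr>carrier = {z. \<exists>n. z ^ (p ^ n) = 1}, monoid.mult = (*), one = 1\<rparr>"

definition finite_sum_of_prufer_groups :: "nat \<Rightarrow> ('a, 'm) monoid_scheme \<Rightarrow> bool" where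
  "finite_sum_of_prufer_groups p G \<longleftrightarrow>
     (\<exists>n::nat. n > 0 \<and> G \<cong> sum_group {..<n} (\<lambda>_. prufer_group p))"

definition torsion_group :: "('a, 'm) monoid_scheme \<Rightarrow> bool" where
  "torsion_group G \<longleftrightarrow> (\<forall>x\<in>carrier G. \<exists>n::nat. n > 0 \<and> x [^]\<^bsub>G\<^esub> n = \<one>\<^bsub>G\<^esub>)"

end

theory Submission
  imports Defs "HOL-Number_Theory.Cong"
begin

text \<open>By compactness, incomparability is transitive on a cofinite part of the small model, so moving
  finitely many elements to the bottom gives a definable total preorder on the group. By minimality
  its classes are finite and each initial segment is finite or cofinite. A minimal group is
  commutative, and either it has prime exponent or all p-th power maps are onto with finite kernel.
  In the latter case, counting how many elements of a finite initial segment leave it under a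
  translation shows that every translation preserves almost all classes, so the group is torsion. If
  the p-th power map is not injective, comparing a segment with its preimage shows that almost
  always the p-th power of x lies strictly below x. Applied to a definable chain of finite subgroups
  exhausting the group, this excludes two different primes. Finally, in a divisible p-group with
  finite socle, embeddings of sums of Pruefer groups can be extended until they are onto.\<close>

section \<open>Definable relations\<close>

text \<open>The hypothesis concerns realizations of the generic type in the monster model, while
  every count takes place in the small model. Saturation is available for types in one variable
  only, so a triple violating transitivity is built one coordinate at a time. Nothing makes the
  order compatible with the group law; counting replaces compatibility. A translation, being
  injective, pushes as many elements out of a finite initial segment as it pulls in, and a
  surjective power map with nontrivial kernel gives a segment a preimage at least twice as large.
  Both counts need finite segments, whereas minimality also allows cofinite ones; but the order or
  its converse has infinitely many finite segments. Translation by a is compared with translation by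
  a root of a, which is where divisibility enters. For two primes p and q, the element x is
  recovered from its p-th and q-th powers by Bezout; this requires an order whose initial segments
  are closed under products, and that is why the order is replaced by one coming from a chain of
  subgroups.\<close>

definition dfn :: "('f, 'r) lang \<Rightarrow> ('f, 'r, 'a) struct \<Rightarrow> 'a set \<Rightarrow> ((nat \<Rightarrow> 'a) \<Rightarrow> bool) \<Rightarrow> bool" where
  "dfn L N A P \<longleftrightarrow> (\<exists>\<phi>. is_fm L A \<phi> \<and> (\<forall>e. range e \<subseteq> univ N \<longrightarrow> (sat N e \<phi> \<longleftrightarrow> P e)))"

text \<open>Like \<open>dfn\<close>, a property of functions of the assignment rather than of
  syntax, so that definability can be proved backwards from the shape of a predicate. Free variables
  are not bounded; \<open>dfn_unary_formula\<close> removes the surplus ones.\<close>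

definition dtm :: "('f, 'r) lang \<Rightarrow> ('f, 'r, 'a) struct \<Rightarrow> 'a set \<Rightarrow> ((nat \<Rightarrow> 'a) \<Rightarrow> 'a) \<Rightarrow> bool" where
  "dtm L N A t \<longleftrightarrow> (\<exists>s. is_trm L A s \<and> (\<forall>e. range e \<subseteq> univ N \<longrightarrow> val N e s = t e))"

section \<open>Values and truth depend on the free variables only\<close>

lemma val_fv_cong: "(\<And>n. n \<in> fv_trm t \<Longrightarrow> e n = e' n) \<Longrightarrow> val N e t = val N e' t"
proof (induction t)
  case (App f ts)
  then have "map (val N e) ts = map (val N e') ts" by auto
  then show ?case by (simp only: val.simps)
qed auto

lemma sat_fv_cong: "(\<And>n. n \<in> fv \<phi> \<Longrightarrow> e n = e' n) \<Longrightarrow> sat N e \<phi> = sat N e' \<phi>"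
proof (induction \<phi> arbitrary: e e')
  case (Eql s t)
  then show ?case using val_fv_cong[of s e e' N] val_fv_cong[of t e e' N] by auto
next
  case (Atm r ts)
  then have "map (val N e) ts = map (val N e') ts" by (auto intro!: val_fv_cong)
  then show ?case by (simp only: sat.simps)
next
  case (Neg \<phi>)
  then show ?case by (metis fv.simps(3) sat.simps(3))
next
  case (Conj \<phi> \<psi>)
  have "sat N e \<phi> = sat N e' \<phi>" "sat N e \<psi> = sat N e' \<psi>"
    using Conj.prems by (auto intro!: Conj.IH)
  then show ?case by simp
next
  case (Exi n \<phi>)
  have "sat N (e(n := a)) \<phi> = sat N (e'(n := a)) \<phi>" for a
    by (rule Exi.IH) (use Exi.prems in auto)
  then show ?case by simp
qed

lemma val_in_univ:
  "is_struct L N \<Longrightarrow> A \<subseteq> univ N \<Longrightarrow> is_trm L A t \<Longrightarrow> range e \<subseteq> univ N \<Longrightarrow> val N e t \<in> univ N"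
proof (induction t)
  case (App f ts)
  then have "set (map (val N e) ts) \<subseteq> univ N" "length (map (val N e) ts) = farity L f" by auto
  then show ?case using App.prems unfolding is_struct_def by (metis is_trm.simps(3) val.simps(3))
qed auto

lemma finite_fv_trm: "finite (fv_trm t)"
  by (induction t) auto

lemma finite_fv: "finite (fv \<phi>)"
  by (induction \<phi>) (auto simp: finite_fv_trm)

lemma dfnI: "is_fm L A \<phi> \<Longrightarrow> (\<And>e. range e \<subseteq> univ N \<Longrightarrow> sat N e \<phi> \<longleftrightarrow> P e) \<Longrightarrow> dfn L N A P"
  unfolding dfn_def by blast

section \<open>Closure of definability under logical operations\<close>

lemma dfn_neg: assumes "dfn L N A P" shows "dfn L N A (\<lambda>e. \<not> P e)"
proof -
  from assms obtain \<phi> where "is_fm L A \<phi>" "\<And>e. range e \<subseteq> univ N \<Longrightarrow> sat N e \<phi> \<longleftrightarrow> P e"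
    unfolding dfn_def by blast
  then show ?thesis by (intro dfnI[of _ _ "Neg \<phi>"]) auto
qed

lemma dfn_conj: assumes "dfn L N A P" "dfn L N A Q" shows "dfn L N A (\<lambda>e. P e \<and> Q e)"
proof -
  from assms obtain \<phi> \<psi> where "is_fm L A \<phi>" "\<And>e. range e \<subseteq> univ N \<Longrightarrow> sat N e \<phi> \<longleftrightarrow> P e"
    "is_fm L A \<psi>" "\<And>e. range e \<subseteq> univ N \<Longrightarrow> sat N e \<psi> \<longleftrightarrow> Q e"
    unfolding dfn_def by blast
  then show ?thesis by (intro dfnI[of _ _ "Conj \<phi> \<psi>"]) auto
qed

lemma dfn_disj: assumes "dfn L N A P" "dfn L N A Q" shows "dfn L N A (\<lambda>e. P e \<or> Q e)"
  using dfn_neg[OF dfn_conj[OF dfn_neg[OF assms(1)] dfn_neg[OF assms(2)]]] by simp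

lemma dfn_imp: assumes "dfn L N A P" "dfn L N A Q" shows "dfn L N A (\<lambda>e. P e \<longrightarrow> Q e)"
  unfolding imp_conv_disj by (intro dfn_disj dfn_neg assms)

lemma dfn_ex: assumes "dfn L N A P" shows "dfn L N A (\<lambda>e. \<exists>a\<in>univ N. P (e(n := a)))"
proof -
  from assms obtain \<phi> where \<phi>: "is_fm L A \<phi>" "\<And>e. range e \<subseteq> univ N \<Longrightarrow> sat N e \<phi> \<longleftrightarrow> P e"
    unfolding dfn_def by blast
  have "range (e(n := a)) \<subseteq> univ N" if "range e \<subseteq> univ N" "a \<in> univ N" for a e
    using that by auto
  then show ?thesis by (intro dfnI[of _ _ "Exi n \<phi>"]) (auto simp: \<phi>)
qed

lemma dfn_all: assumes "dfn L N A P" shows "dfn L N A (\<lambda>e. \<forall>a\<in>univ N. P (e(n := a)))"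
  using dfn_neg[OF dfn_ex[OF dfn_neg[OF assms], of n]] by simp

lemma dfn_eq: assumes "dtm L N A t" "dtm L N A s" shows "dfn L N A (\<lambda>e. t e = s e)"
proof -
  from assms obtain t' s' where "is_trm L A t'" "\<And>e. range e \<subseteq> univ N \<Longrightarrow> val N e t' = t e"
    "is_trm L A s'" "\<And>e. range e \<subseteq> univ N \<Longrightarrow> val N e s' = s e"
    unfolding dtm_def by metis
  then show ?thesis by (intro dfnI[of _ _ "Eql t' s'"]) auto
qed

lemma dtm_var: "dtm L N A (\<lambda>e. e n)"
  unfolding dtm_def by (rule exI[of _ "Var n"]) auto

lemma dtm_par: "a \<in> A \<Longrightarrow> dtm L N A (\<lambda>e. a)"
  unfolding dtm_def by (rule exI[of _ "Par a"]) auto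

lemma dfn_const: "dfn L N A (\<lambda>e. c)"
proof (cases c)
  case True
  then show ?thesis using dfn_eq[OF dtm_var[of L N A 0] dtm_var[of L N A 0]] by simp
next
  case False
  then show ?thesis using dfn_neg[OF dfn_eq[OF dtm_var[of L N A 0] dtm_var[of L N A 0]]] by simp
qed

lemma dfn_in_finite:
  assumes "finite F" "F \<subseteq> A" "dtm L N A t"
  shows "dfn L N A (\<lambda>e. t e \<in> F)"
  using assms(1,2)
proof (induction F rule: finite_induct)
  case (insert a F)
  then have "dfn L N A (\<lambda>e. t e = a \<or> t e \<in> F)"
    by (intro dfn_disj dfn_eq dtm_par assms(3)) auto
  then show ?case by simp
qed (simp add: dfn_const)

text \<open>Terms are substituted by quantifying over fresh copies of the variables, which avoids capture.\<close>

lemma dfn_subst: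
  assumes N: "is_struct L N" "A \<subseteq> univ N"
    and R: "dfn L N A (\<lambda>e. R (e 0) (e 1))" and t: "dtm L N A t" and s: "dtm L N A s"
  shows "dfn L N A (\<lambda>e. R (t e) (s e))"
proof -
  obtain \<phi> where \<phi>: "is_fm L A \<phi>" "\<And>e. range e \<subseteq> univ N \<Longrightarrow> sat N e \<phi> \<longleftrightarrow> R (e 0) (e 1)"
    using R unfolding dfn_def by blast
  obtain t' where t': "is_trm L A t'" "\<And>e. range e \<subseteq> univ N \<Longrightarrow> val N e t' = t e"
    using t unfolding dtm_def by metis
  obtain s' where s': "is_trm L A s'" "\<And>e. range e \<subseteq> univ N \<Longrightarrow> val N e s' = s e"
    using s unfolding dtm_def by metis
  define B where "B = fv_trm t' \<union> fv_trm s' \<union> {0, 1}"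
  have "finite B" by (simp add: B_def finite_fv_trm)
  then obtain m where m: "m \<notin> B" using ex_new_if_finite infinite_UNIV_nat by blast
  have "finite (insert m B)" using \<open>finite B\<close> by simp
  then obtain k where k: "k \<notin> insert m B" using ex_new_if_finite infinite_UNIV_nat by blast
  let ?\<psi> = "Exi m (Conj (Eql (Var m) t') (Exi k (Conj (Eql (Var k) s')
     (Exi 0 (Conj (Eql (Var 0) (Var m)) (Exi 1 (Conj (Eql (Var 1) (Var k)) \<phi>)))))))"
  show ?thesis
  proof (rule dfnI[of _ _ ?\<psi>])
    show "is_fm L A ?\<psi>" using \<phi>(1) t'(1) s'(1) by simp
    fix e :: "nat \<Rightarrow> _" assume e: "range e \<subseteq> univ N"
    have nk: "m \<noteq> 0" "m \<noteq> 1" "k \<noteq> 0" "k \<noteq> 1" "k \<noteq> m" using m k by (auto simp: B_def)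
    have v1: "val N (e(m := a)) t' = t e" for a
      unfolding t'(2)[OF e, symmetric] by (rule val_fv_cong) (use m in \<open>auto simp: B_def\<close>)
    have v2: "val N (e(m := a, k := b)) s' = s e" for a b
      unfolding s'(2)[OF e, symmetric] by (rule val_fv_cong) (use m k in \<open>auto simp: B_def\<close>)
    have te: "t e \<in> univ N" using val_in_univ[OF N t'(1) e] t'(2)[OF e] by simp
    have se: "s e \<in> univ N" using val_in_univ[OF N s'(1) e] s'(2)[OF e] by simp
    have "range (e(m := t e, k := s e, 0 := t e, 1 := s e)) \<subseteq> univ N"
      using e te se by auto
    from \<phi>(2)[OF this] show "sat N e ?\<psi> \<longleftrightarrow> R (t e) (s e)"
      using nk te se by (simp add: v1 v2)
  qed
qed

text \<open>Truth depends on \<open>e 0\<close> alone, so surplus free variables can be bound by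
  existential quantifiers one after the other without changing the meaning; the universe is
  nonempty, so such a quantifier always has a witness.\<close>

lemma dfn_unary_formula:
  assumes "univ N \<noteq> {}" and P: "dfn L N A (\<lambda>e. P (e 0))"
  obtains \<phi> where "\<phi> \<in> fm1 L A" "solutions N \<phi> = {x \<in> univ N. P x}"
proof -
  obtain \<phi> where \<phi>: "is_fm L A \<phi>" "\<And>e. range e \<subseteq> univ N \<Longrightarrow> sat N e \<phi> \<longleftrightarrow> P (e 0)"
    using P unfolding dfn_def by blast
  have "\<exists>\<psi>. is_fm L A \<psi> \<and> fv \<psi> = fv \<phi> - B \<and>
      (\<forall>e. range e \<subseteq> univ N \<longrightarrow> (sat N e \<psi> \<longleftrightarrow> P (e 0)))"
    if "finite B" "0 \<notin> B" for B
    using that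
  proof (induction B rule: finite_induct)
    case empty
    then show ?case using \<phi> by auto
  next
    case (insert n B)
    then obtain \<psi> where \<psi>: "is_fm L A \<psi>" "fv \<psi> = fv \<phi> - B"
      "\<And>e. range e \<subseteq> univ N \<Longrightarrow> sat N e \<psi> \<longleftrightarrow> P (e 0)" by auto
    have "sat N e (Exi n \<psi>) \<longleftrightarrow> P (e 0)" if "range e \<subseteq> univ N" for e
    proof -
      have "range (e(n := a)) \<subseteq> univ N" if "a \<in> univ N" for a
        using that \<open>range e \<subseteq> univ N\<close> by auto
      then show ?thesis using \<psi>(3) insert.prems assms(1) by auto
    qed
    then show ?case using \<psi>(1,2) by (intro exI[of _ "Exi n \<psi>"]) auto
  qed
  from this[of "fv \<phi> - {0}"] obtain \<psi> where \<psi>: "is_fm L A \<psi>" "fv \<psi> \<subseteq> {0}"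
    "\<And>e. range e \<subseteq> univ N \<Longrightarrow> sat N e \<psi> \<longleftrightarrow> P (e 0)" using finite_fv[of \<phi>] by auto
  have "sat N (\<lambda>_. a) \<psi> \<longleftrightarrow> P a" if "a \<in> univ N" for a
    using \<psi>(3)[of "\<lambda>_. a"] that by auto
  then have "solutions N \<psi> = {x \<in> univ N. P x}"
    unfolding solutions_def by auto
  then show ?thesis using that \<psi>(1,2) unfolding fm1_def by blast
qed

lemma minimal_structure_dfn:
  assumes "minimal_structure L M" "dfn L M (univ M) (\<lambda>e. P (e 0))"
  shows "finite {x \<in> univ M. P x} \<or> finite {x \<in> univ M. \<not> P x}"
proof -
  have "univ M \<noteq> {}" using assms(1) unfolding minimal_structure_def by auto
  then obtain \<phi> where "\<phi> \<in> fm1 L (univ M)" "solutions M \<phi> = {x \<in> univ M. P x}"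
    by (rule dfn_unary_formula[where P = P, OF _ assms(2)])
  then have "finite {x \<in> univ M. P x} \<or> finite (univ M - {x \<in> univ M. P x})"
    using assms(1) unfolding minimal_structure_def by metis
  moreover have "univ M - {x \<in> univ M. P x} = {x \<in> univ M. \<not> P x}" by auto
  ultimately show ?thesis by simp
qed


section \<open>Elements outside the model realize the generic type\<close>

fun par_trm :: "('f, 'r, 'a) trm \<Rightarrow> 'a set" where
  "par_trm (Var n) = {}"
| "par_trm (Par a) = {a}"
| "par_trm (App f ts) = (\<Union>t\<in>set ts. par_trm t)"

fun par_fm :: "('f, 'r, 'a) fm \<Rightarrow> 'a set" where
  "par_fm (Eql s t) = par_trm s \<union> par_trm t"
| "par_fm (Atm r ts) = (\<Union>t\<in>set ts. par_trm t)"
| "par_fm (Neg \<phi>) = par_fm \<phi>"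
| "par_fm (Conj \<phi> \<psi>) = par_fm \<phi> \<union> par_fm \<psi>"
| "par_fm (Exi n \<phi>) = par_fm \<phi>"

fun bv :: "('f, 'r, 'a) fm \<Rightarrow> nat set" where
  "bv (Eql s t) = {}"
| "bv (Atm r ts) = {}"
| "bv (Neg \<phi>) = bv \<phi>"
| "bv (Conj \<phi> \<psi>) = bv \<phi> \<union> bv \<psi>"
| "bv (Exi n \<phi>) = insert n (bv \<phi>)"

text \<open>\<open>elem_ext\<close> compares the models on formulas without parameters, so each
  parameter a is replaced by a variable \<open>g a\<close> to which the assignment gives the value
  a.\<close>

fun depar_trm :: "('a \<Rightarrow> nat) \<Rightarrow> ('f, 'r, 'a) trm \<Rightarrow> ('f, 'r, 'a) trm" where
  "depar_trm g (Var n) = Var n"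
| "depar_trm g (Par a) = Var (g a)"
| "depar_trm g (App f ts) = App f (map (depar_trm g) ts)"

fun depar :: "('a \<Rightarrow> nat) \<Rightarrow> ('f, 'r, 'a) fm \<Rightarrow> ('f, 'r, 'a) fm" where
  "depar g (Eql s t) = Eql (depar_trm g s) (depar_trm g t)"
| "depar g (Atm r ts) = Atm r (map (depar_trm g) ts)"
| "depar g (Neg \<phi>) = Neg (depar g \<phi>)"
| "depar g (Conj \<phi> \<psi>) = Conj (depar g \<phi>) (depar g \<psi>)"
| "depar g (Exi n \<phi>) = Exi n (depar g \<phi>)"

lemma finite_par_trm: "finite (par_trm t)"
  by (induction t) auto

lemma finite_par_fm: "finite (par_fm \<phi>)"
  by (induction \<phi>) (auto simp: finite_par_trm)

lemma finite_bv: "finite (bv \<phi>)"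
  by (induction \<phi>) auto

lemma is_trm_par: "is_trm L A t \<Longrightarrow> par_trm t \<subseteq> A"
  by (induction t) auto

lemma is_fm_par: "is_fm L A \<phi> \<Longrightarrow> par_fm \<phi> \<subseteq> A"
  by (induction \<phi>) (use is_trm_par in fastforce)+

lemma is_trm_depar: "is_trm L A t \<Longrightarrow> is_trm L {} (depar_trm g t)"
  by (induction t) auto

lemma is_fm_depar: "is_fm L A \<phi> \<Longrightarrow> is_fm L {} (depar g \<phi>)"
  by (induction \<phi>) (auto simp: is_trm_depar)

lemma fv_depar_trm: "fv_trm (depar_trm g t) \<subseteq> fv_trm t \<union> g ` par_trm t"
  by (induction t) fastforce+

lemma fv_depar: "fv (depar g \<phi>) \<subseteq> fv \<phi> \<union> g ` par_fm \<phi>"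
proof (induction \<phi>)
  case (Eql s t)
  then show ?case using fv_depar_trm[of g s] fv_depar_trm[of g t] by auto
next
  case (Atm r ts)
  then show ?case using fv_depar_trm[of g] by fastforce
qed auto

lemma val_depar: "(\<And>a. a \<in> par_trm t \<Longrightarrow> e (g a) = a) \<Longrightarrow> val N e (depar_trm g t) = val N e t"
proof (induction t)
  case (App f ts)
  then have "map (val N e) (map (depar_trm g) ts) = map (val N e) ts" by auto
  then show ?case by (metis depar_trm.simps(3) val.simps(3))
qed auto

text \<open>The new variables must avoid the bound ones, since a quantifier would otherwise
  overwrite the value that stands for the parameter.\<close>

lemma sat_depar:
  "(\<And>a. a \<in> par_fm \<phi> \<Longrightarrow> e (g a) = a \<and> g a \<notin> bv \<phi>) \<Longrightarrow> sat N e (depar g \<phi>) = sat N e \<phi>"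
proof (induction \<phi> arbitrary: e)
  case (Eql s t)
  then show ?case using val_depar[of s e g N] val_depar[of t e g N] by auto
next
  case (Atm r ts)
  then have "map (val N e) (map (depar_trm g) ts) = map (val N e) ts" by (auto intro!: val_depar)
  then show ?case by (metis depar.simps(2) sat.simps(2))
next
  case (Neg \<phi>)
  then show ?case by simp
next
  case (Conj \<phi> \<psi>)
  have "sat N e (depar g \<phi>) = sat N e \<phi>" "sat N e (depar g \<psi>) = sat N e \<psi>"
    using Conj.prems by (auto intro!: Conj.IH)
  then show ?case by simp
next
  case (Exi n \<phi>)
  have "sat N (e(n := a)) (depar g \<phi>) = sat N (e(n := a)) \<phi>" for a
    by (rule Exi.IH) (use Exi.prems in auto)
  then show ?case by simp
qed

text \<open>The number b exceeds all free and bound variables of \<phi>. Numbering the parameters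
  injectively from b on, and extending the assignment there by the inverse numbering, reduces the
  claim to formulas without parameters.\<close>

lemma elem_ext_par:
  fixes M N :: "('f, 'r, 'a) struct"
  assumes MN: "elem_ext L M N" and \<phi>: "is_fm L (univ M) \<phi>" and e: "e ` fv \<phi> \<subseteq> univ M"
  shows "sat M e \<phi> \<longleftrightarrow> sat N e \<phi>"
proof -
  have "finite (fv \<phi> \<union> bv \<phi>)" by (simp add: finite_fv finite_bv)
  then obtain b where b: "\<forall>n\<in>fv \<phi> \<union> bv \<phi>. n < b"
    unfolding finite_nat_set_iff_bounded by blast
  obtain h :: "'a \<Rightarrow> nat" where h: "inj_on h (par_fm \<phi>)"
    using finite_imp_inj_to_nat_seg[OF finite_par_fm[of \<phi>]] by auto
  define g where "g a = b + h a" for a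
  have g: "inj_on g (par_fm \<phi>)" using h by (auto simp: g_def inj_on_def)
  define e' where "e' n = (if n < b then e n else inv_into (par_fm \<phi>) g n)" for n
  have e'g: "e' (g a) = a \<and> g a \<notin> bv \<phi>" if "a \<in> par_fm \<phi>" for a
  proof -
    have "b \<le> g a" by (simp add: g_def)
    then have "e' (g a) = a" using inv_into_f_f[OF g that] by (simp add: e'_def)
    moreover have "g a \<notin> bv \<phi>" using b \<open>b \<le> g a\<close> by (metis UnI2 leD)
    ultimately show ?thesis ..
  qed
  have ee: "sat K e \<phi> = sat K e' \<phi>" for K :: "('f, 'r, 'a) struct"
    by (rule sat_fv_cong) (use b in \<open>auto simp: e'_def\<close>)
  have "e' ` fv (depar g \<phi>) \<subseteq> univ M"
  proof
    fix x assume "x \<in> e' ` fv (depar g \<phi>)"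
    then obtain n where n: "x = e' n" "n \<in> fv \<phi> \<union> g ` par_fm \<phi>"
      using fv_depar[of g \<phi>] by auto
    show "x \<in> univ M"
    proof (cases "n \<in> fv \<phi>")
      case True
      then have "e' n = e n" using b by (simp add: e'_def)
      then show ?thesis using n True e by auto
    next
      case False
      then show ?thesis using n e'g is_fm_par[OF \<phi>] by auto
    qed
  qed
  then have "sat M e' (depar g \<phi>) \<longleftrightarrow> sat N e' (depar g \<phi>)"
    using MN is_fm_depar[OF \<phi>] unfolding elem_ext_def by blast
  then show ?thesis using sat_depar[OF e'g] ee by metis
qed

text \<open>Resolves the definite description in \<open>generic_type\<close>. By minimality the
  formulas with cofinite solution sets form a complete type, and it is not algebraic because the
  universe is infinite. A nonalgebraic complete type contains no formula with finitely many
  solutions, so it is contained in this one, and completeness gives equality.\<close>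

lemma generic_type_eq:
  assumes M: "minimal_structure L M"
  shows "generic_type L M = {\<phi> \<in> fm1 L (univ M). finite (univ M - solutions M \<phi>)}" (is "_ = ?C")
proof -
  have inf: "infinite (univ M)"
    and dich: "\<And>\<phi>. \<phi> \<in> fm1 L (univ M) \<Longrightarrow> finite (solutions M \<phi>) \<or> finite (univ M - solutions M \<phi>)"
    using M unfolding minimal_structure_def by auto
  have neg: "solutions M (Neg \<phi>) = univ M - solutions M \<phi>" for \<phi>
    unfolding solutions_def by auto
  have neg1: "Neg \<phi> \<in> fm1 L (univ M) \<longleftrightarrow> \<phi> \<in> fm1 L (univ M)" for \<phi>
    unfolding fm1_def by auto
  have sub: "solutions M \<phi> \<subseteq> univ M" for \<phi> unfolding solutions_def by auto
  have both: False if "finite (solutions M \<phi>)" "finite (univ M - solutions M \<phi>)" for \<phi>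
    using that inf finite_Diff2 by blast
  have C: "?C \<in> complete_types L M (univ M) \<and> \<not> algebraic_type M ?C"
  proof
    have fs: "\<exists>a\<in>univ M. \<forall>\<phi>\<in>F. a \<in> solutions M \<phi>" if "finite F" "F \<subseteq> ?C" for F
    proof -
      have "finite (\<Union>\<phi>\<in>F. univ M - solutions M \<phi>)"
        using that by (intro finite_UN_I) auto
      then obtain a where "a \<in> univ M" "a \<notin> (\<Union>\<phi>\<in>F. univ M - solutions M \<phi>)"
        using inf by (meson finite_subset subsetI)
      then show ?thesis by auto
    qed
    have comp: "Neg \<phi> \<in> ?C" if "\<phi> \<in> fm1 L (univ M)" "\<phi> \<notin> ?C" for \<phi>
    proof -
      have "finite (solutions M \<phi>)" using that dich by auto
      moreover have "univ M - solutions M (Neg \<phi>) = solutions M \<phi>" using neg sub by auto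
      ultimately show ?thesis using that neg1 by auto
    qed
    show "?C \<in> complete_types L M (univ M)"
      unfolding complete_types_def
    proof (rule CollectI, intro conjI ballI allI impI)
      show "?C \<subseteq> fm1 L (univ M)" by blast
      show "\<exists>a\<in>univ M. \<forall>\<phi>\<in>F. a \<in> solutions M \<phi>" if "finite F \<and> F \<subseteq> ?C" for F
        using fs that by blast
      show "\<phi> \<in> ?C \<or> Neg \<phi> \<in> ?C" if "\<phi> \<in> fm1 L (univ M)" for \<phi>
        using comp[OF that] by blast
    qed
    show "\<not> algebraic_type M ?C" using both unfolding algebraic_type_def by auto
  qed
  moreover have "p = ?C" if p: "p \<in> complete_types L M (univ M) \<and> \<not> algebraic_type M p" for p
  proof
    have p1: "p \<subseteq> fm1 L (univ M)" using p unfolding complete_types_def by blast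
    then show "p \<subseteq> ?C" using dich p unfolding algebraic_type_def by blast
    show "?C \<subseteq> p"
    proof
      fix \<phi> assume \<phi>: "\<phi> \<in> ?C"
      then have "\<phi> \<in> p \<or> Neg \<phi> \<in> p" using p unfolding complete_types_def by blast
      moreover have "Neg \<phi> \<notin> p" using p neg[of \<phi>] \<phi> unfolding algebraic_type_def by auto
      ultimately show "\<phi> \<in> p" by simp
    qed
  qed
  ultimately show ?thesis unfolding generic_type_def by (intro the_equality) blast+
qed

text \<open>A formula of the generic type has finitely many exceptions in M. They can be named, so
  the fact that there are no others passes to N, and an element outside M is none of them.\<close>

lemma outside_realizes_generic:
  fixes M N :: "('f, 'r, 'a) struct"
  assumes M: "minimal_structure L M" and MN: "elem_ext L M N"
  shows "univ N - univ M \<subseteq> realizations N (generic_type L M)"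
proof
  fix a assume a: "a \<in> univ N - univ M"
  have "a \<in> solutions N \<phi>" if \<phi>: "\<phi> \<in> fm1 L (univ M)" and fin: "finite (univ M - solutions M \<phi>)" for \<phi>
  proof -
    let ?F = "univ M - solutions M \<phi>"
    obtain xs where xs: "set xs = ?F" using fin finite_list by blast
    \<comment> \<open>\<chi> describes an exception to \<phi> that is different from all the named
      ones; its existential closure fails in M.\<close>
    define \<chi> where "\<chi> = foldr (\<lambda>c \<psi>. Conj (Neg (Eql (Var 0) (Par c))) \<psi>) xs (Neg \<phi>)"
    have \<chi>: "sat K e \<chi> \<longleftrightarrow> e 0 \<notin> ?F \<and> \<not> sat K e \<phi>" for e and K :: "('f, 'r, 'a) struct"
      unfolding \<chi>_def xs[symmetric] by (induction xs) auto
    have fm: "is_fm L (univ M) \<chi>" if "set xs \<subseteq> univ M"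
      using that \<phi> unfolding \<chi>_def fm1_def by (induction xs) auto
    have fv: "fv \<chi> \<subseteq> {0}" using \<phi> unfolding \<chi>_def fm1_def by (induction xs) auto
    have cong: "sat K (e(0 := c)) \<phi> \<longleftrightarrow> sat K (\<lambda>_. c) \<phi>" for e c and K :: "('f, 'r, 'a) struct"
      by (rule sat_fv_cong) (use \<phi> in \<open>auto simp: fm1_def\<close>)
    have "sat M (\<lambda>_. a) (Exi 0 \<chi>) \<longleftrightarrow> sat N (\<lambda>_. a) (Exi 0 \<chi>)"
      using fm fv xs by (intro elem_ext_par[OF MN]) auto
    moreover have "\<not> sat M (\<lambda>_. a) (Exi 0 \<chi>)"
      by (auto simp: \<chi> cong solutions_def)
    ultimately have "\<not> sat N ((\<lambda>_. a)(0 := a)) \<chi>" using a by auto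
    then show ?thesis using a cong[of N "\<lambda>_. a" a] by (auto simp: \<chi> solutions_def)
  qed
  then show "a \<in> realizations N (generic_type L M)"
    using a unfolding generic_type_eq[OF M] realizations_def by auto
qed


section \<open>Saturation\<close>

text \<open>A maximal finitely satisfiable set of formulas exists by Zorn. If it contained neither a
  formula nor its negation, adding either would break finite satisfiability, and the two finite
  reasons together would leave no element satisfying both.\<close>

lemma extend_to_complete_type:
  assumes sub: "\<Sigma> \<subseteq> fm1 L A"
    and fs: "\<And>F. finite F \<Longrightarrow> F \<subseteq> \<Sigma> \<Longrightarrow> \<exists>a\<in>univ N. \<forall>\<phi>\<in>F. a \<in> solutions N \<phi>"
  obtains p where "\<Sigma> \<subseteq> p" "p \<in> complete_types L N A"
proof -
  define fsat where "fsat q \<longleftrightarrow> (\<forall>F. finite F \<and> F \<subseteq> q \<longrightarrow> (\<exists>a\<in>univ N. \<forall>\<phi>\<in>F. a \<in> solutions N \<phi>))" for q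
  define Q where "Q = {q. \<Sigma> \<subseteq> q \<and> q \<subseteq> fm1 L A \<and> fsat q}"
  have "fsat \<Sigma>" unfolding fsat_def by (intro allI impI fs) auto
  then have SQ: "\<Sigma> \<in> Q" using sub unfolding Q_def by blast
  have "\<exists>p\<in>Q. \<forall>q\<in>Q. p \<subseteq> q \<longrightarrow> q = p"
  proof (rule subset_Zorn_nonempty)
    show "Q \<noteq> {}" using SQ by auto
    fix \<C> assume C: "\<C> \<noteq> {}" "subset.chain Q \<C>"
    have "fsat (\<Union>\<C>)"
      unfolding fsat_def
    proof (intro allI impI)
      fix F assume F: "finite F \<and> F \<subseteq> \<Union>\<C>"
      then obtain q where "q \<in> \<C>" "F \<subseteq> q"
        using finite_subset_Union_chain[of F \<C> Q] C by blast
      then show "\<exists>a\<in>univ N. \<forall>\<phi>\<in>F. a \<in> solutions N \<phi>"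
        using F C(2) unfolding subset.chain_def Q_def fsat_def by blast
    qed
    then show "\<Union>\<C> \<in> Q" using C unfolding subset.chain_def Q_def by blast
  qed
  then obtain p where p: "p \<in> Q" and max: "\<And>q. q \<in> Q \<Longrightarrow> p \<subseteq> q \<Longrightarrow> q = p" by blast
  have "\<phi> \<in> p \<or> Neg \<phi> \<in> p" if \<phi>: "\<phi> \<in> fm1 L A" for \<phi>
  proof (rule ccontr)
    assume n: "\<not> (\<phi> \<in> p \<or> Neg \<phi> \<in> p)"
    have ins: "\<exists>F. finite F \<and> F \<subseteq> p \<and> (\<forall>a\<in>univ N. (\<forall>\<theta>\<in>F. a \<in> solutions N \<theta>) \<longrightarrow> a \<notin> solutions N \<psi>)"
      if \<psi>: "\<psi> \<in> fm1 L A" "\<psi> \<notin> p" for \<psi>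
    proof -
      have "insert \<psi> p \<notin> Q" using max[of "insert \<psi> p"] that by blast
      then have "\<not> fsat (insert \<psi> p)" using p \<psi> unfolding Q_def by blast
      then obtain F where F: "finite F" "F \<subseteq> insert \<psi> p" "\<not> (\<exists>a\<in>univ N. \<forall>\<phi>\<in>F. a \<in> solutions N \<phi>)"
        unfolding fsat_def by blast
      have "finite (F - {\<psi>})" "F - {\<psi>} \<subseteq> p" using F by auto
      moreover have "\<forall>a\<in>univ N. (\<forall>\<theta>\<in>F - {\<psi>}. a \<in> solutions N \<theta>) \<longrightarrow> a \<notin> solutions N \<psi>"
        using F(3) by blast
      ultimately show ?thesis by blast
    qed
    have "Neg \<phi> \<in> fm1 L A" using \<phi> unfolding fm1_def by auto
    obtain F1 where F1: "finite F1" "F1 \<subseteq> p"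
      "\<forall>a\<in>univ N. (\<forall>\<theta>\<in>F1. a \<in> solutions N \<theta>) \<longrightarrow> a \<notin> solutions N \<phi>"
      using ins[OF \<phi>] n by blast
    obtain F2 where F2: "finite F2" "F2 \<subseteq> p"
      "\<forall>a\<in>univ N. (\<forall>\<theta>\<in>F2. a \<in> solutions N \<theta>) \<longrightarrow> a \<notin> solutions N (Neg \<phi>)"
      using ins[OF \<open>Neg \<phi> \<in> fm1 L A\<close>] n by blast
    have "finite (F1 \<union> F2) \<and> F1 \<union> F2 \<subseteq> p" using F1 F2 by auto
    then obtain a where a: "a \<in> univ N" "\<forall>\<theta>\<in>F1 \<union> F2. a \<in> solutions N \<theta>"
      using p unfolding Q_def fsat_def by blast
    then show False using F1(3) F2(3) unfolding solutions_def by auto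
  qed
  moreover have "p \<subseteq> fm1 L A" "fsat p" "\<Sigma> \<subseteq> p" using p unfolding Q_def by blast+
  ultimately have "p \<in> complete_types L N A"
    unfolding complete_types_def fsat_def by simp
  with \<open>\<Sigma> \<subseteq> p\<close> show ?thesis by (rule that)
qed

text \<open>\<open>saturated\<close> speaks of complete types; here it is brought into the form of
  compactness for arbitrary families of definable conditions over a small set.\<close>

lemma saturated_directed:
  assumes sat: "saturated L \<kappa> N" and A: "A \<subseteq> univ N" "|A| <o \<kappa>" and ne: "univ N \<noteq> {}"
    and def_P: "\<And>i. i \<in> I \<Longrightarrow> dfn L N A (\<lambda>e. P i (e 0))"
    and dir: "\<And>J. finite J \<Longrightarrow> J \<subseteq> I \<Longrightarrow> \<exists>x\<in>univ N. \<forall>i\<in>J. P i x"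
  shows "\<exists>x\<in>univ N. \<forall>i\<in>I. P i x"
proof -
  have "\<exists>\<phi>. \<phi> \<in> fm1 L A \<and> solutions N \<phi> = {x \<in> univ N. P i x}" if "i \<in> I" for i
    by (rule dfn_unary_formula[where P = "P i", OF ne def_P[OF that]]) blast
  then obtain f where f: "\<And>i. i \<in> I \<Longrightarrow> f i \<in> fm1 L A"
    "\<And>i. i \<in> I \<Longrightarrow> solutions N (f i) = {x \<in> univ N. P i x}" by metis
  have "\<exists>a\<in>univ N. \<forall>\<phi>\<in>F. a \<in> solutions N \<phi>" if F: "finite F" "F \<subseteq> f ` I" for F
  proof -
    obtain J where "J \<subseteq> I" "finite J" "F = f ` J"
      using finite_subset_image[OF F] by blast
    then obtain a where a: "a \<in> univ N" "\<forall>i\<in>J. P i a" using dir[of J] by blast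
    have "a \<in> solutions N (f i)" if "i \<in> J" for i
      using a that f(2)[of i] \<open>J \<subseteq> I\<close> by blast
    then show ?thesis using a(1) \<open>F = f ` J\<close> by blast
  qed
  moreover have "f ` I \<subseteq> fm1 L A" using f by auto
  ultimately obtain p where p: "f ` I \<subseteq> p" "p \<in> complete_types L N A"
    using extend_to_complete_type by metis
  then have "realizations N p \<noteq> {}" using sat A unfolding saturated_def by blast
  then obtain a where "a \<in> univ N" "\<forall>\<phi>\<in>p. a \<in> solutions N \<phi>" unfolding realizations_def by auto
  then show ?thesis using p(1) f(2) by blast
qed

text \<open>Supplies elements outside the small model. Avoiding B is avoiding all its finite
  subsets, so it joins the family of conditions indexed by these subsets; monotonicity merges
  finitely many conditions into the one for the union.\<close>

lemma saturated_outside: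
  assumes sat: "saturated L \<kappa> N" and A: "A \<subseteq> univ N" "|A| <o \<kappa>" and ne: "univ N \<noteq> {}"
    and B: "B \<subseteq> A"
    and def_P: "\<And>F. finite F \<Longrightarrow> F \<subseteq> B \<Longrightarrow> dfn L N A (\<lambda>e. P F (e 0))"
    and mono: "\<And>F F' x. F \<subseteq> F' \<Longrightarrow> P F' x \<Longrightarrow> P F x"
    and ex: "\<And>F. finite F \<Longrightarrow> F \<subseteq> B \<Longrightarrow> \<exists>x\<in>univ N. x \<notin> F \<and> P F x"
  shows "\<exists>x\<in>univ N. x \<notin> B \<and> (\<forall>F. finite F \<and> F \<subseteq> B \<longrightarrow> P F x)"
proof -
  let ?I = "{F. finite F \<and> F \<subseteq> B}"
  have "\<exists>x\<in>univ N. \<forall>F\<in>?I. x \<notin> F \<and> P F x"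
  proof (rule saturated_directed[OF sat A ne])
    fix F assume F: "F \<in> ?I"
    then show "dfn L N A (\<lambda>e. e 0 \<notin> F \<and> P F (e 0))"
      using B by (intro dfn_conj dfn_neg dfn_in_finite dtm_var def_P) auto
  next
    fix J assume J: "finite J" "J \<subseteq> ?I"
    then have "finite (\<Union>J)" "\<Union>J \<subseteq> B" by auto
    then obtain x where "x \<in> univ N" "x \<notin> \<Union>J" "P (\<Union>J) x" using ex by blast
    then show "\<exists>x\<in>univ N. \<forall>F\<in>J. x \<notin> F \<and> P F x" using mono by (meson Union_upper Union_iff)
  qed
  then obtain x where x: "x \<in> univ N" "\<forall>F\<in>?I. x \<notin> F \<and> P F x" by blast
  have "x \<notin> B"
  proof
    assume "x \<in> B"
    then have "{x} \<in> ?I" by simp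
    with x(2) show False by blast
  qed
  with x show ?thesis by blast
qed

section \<open>Descent from the monster model to a cofinite part of the small model\<close>

lemma dfn_mono: "dfn L N A P \<Longrightarrow> A \<subseteq> B \<Longrightarrow> dfn L N B P"
proof -
  have t: "is_trm L A t \<Longrightarrow> A \<subseteq> B \<Longrightarrow> is_trm L B t" for t :: "('a, 'b, 'c) trm"
    by (induction t) auto
  have "is_fm L A \<phi> \<Longrightarrow> A \<subseteq> B \<Longrightarrow> is_fm L B \<phi>" for \<phi> :: "('a, 'b, 'c) fm"
    by (induction \<phi>) (use t in auto)
  then show "dfn L N A P \<Longrightarrow> A \<subseteq> B \<Longrightarrow> dfn L N B P" unfolding dfn_def by blast
qed

lemma rel_of_dfn:
  assumes "\<phi> \<in> fm2 L A"
  shows "dfn L N A (\<lambda>e. rel_of N \<phi> (e 0) (e 1))"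
proof (rule dfnI)
  show "is_fm L A \<phi>" using assms unfolding fm2_def by auto
  fix e show "sat N e \<phi> \<longleftrightarrow> rel_of N \<phi> (e 0) (e 1)"
    unfolding rel_of_def by (rule sat_fv_cong) (use assms in \<open>auto simp: fm2_def\<close>)
qed

lemma rel_of_elem_ext:
  assumes "elem_ext L M N" "\<phi> \<in> fm2 L (univ M)" "x \<in> univ M" "y \<in> univ M"
  shows "rel_of M \<phi> x y \<longleftrightarrow> rel_of N \<phi> x y"
  unfolding rel_of_def by (rule elem_ext_par[OF assms(1)]) (use assms in \<open>auto simp: fm2_def\<close>)

text \<open>Otherwise every cofinite part of M contains a triple violating transitivity. Saturation,
  applied to x, y and z in turn, yields such a triple in N outside M. Its members realize the
  generic type, where incomparability is transitive.\<close>

lemma almost_linear_cofinite: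
  fixes M N :: "('f, 'r, 'a) struct"
  assumes M: "minimal_structure L M" and mon: "monster L \<kappa> M N" and al: "almost_linear_order L M N \<phi>"
  obtains F where "finite F" "F \<subseteq> univ M"
    "\<And>x y z. x \<in> univ M - F \<Longrightarrow> y \<in> univ M - F \<Longrightarrow> z \<in> univ M - F \<Longrightarrow>
       incomparability (rel_of M \<phi>) x y \<Longrightarrow> incomparability (rel_of M \<phi>) y z \<Longrightarrow>
       incomparability (rel_of M \<phi>) x z"
proof (rule ccontr)
  note main = that
  assume no: "\<not> thesis"
  let ?M = "univ M" and ?N = "univ N"
  have MN: "elem_ext L M N" and sat: "saturated L \<kappa> N" and card: "|?M| <o \<kappa>"
    using mon unfolding monster_def by blast+
  have sub: "?M \<subseteq> ?N" and N: "is_struct L N" using MN unfolding elem_ext_def by blast+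
  have neN: "?N \<noteq> {}" using N unfolding is_struct_def by auto
  have \<phi>: "\<phi> \<in> fm2 L ?M" using al unfolding almost_linear_order_def by blast
  define R where "R = incomparability (rel_of N \<phi>)"
  define T where "T x y z \<longleftrightarrow> R x y \<and> R y z \<and> \<not> R x z" for x y z
  have RM: "R x y \<longleftrightarrow> incomparability (rel_of M \<phi>) x y" if "x \<in> ?M" "y \<in> ?M" for x y
    using rel_of_elem_ext[OF MN \<phi>] that unfolding R_def incomparability_def by blast
  have T_M: "\<exists>x\<in>?N. x \<notin> F \<and> (\<exists>y\<in>?N. y \<notin> F \<and> (\<exists>z\<in>?N. z \<notin> F \<and> T x y z))"
    if "finite F" "F \<subseteq> ?M" for F
  proof -
    have "\<exists>x\<in>?M - F. \<exists>y\<in>?M - F. \<exists>z\<in>?M - F. incomparability (rel_of M \<phi>) x y \<and>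
        incomparability (rel_of M \<phi>) y z \<and> \<not> incomparability (rel_of M \<phi>) x z"
    proof (rule ccontr)
      assume "\<not> ?thesis"
      then have thesis by (intro main[OF that]) blast
      with no show False ..
    qed
    then obtain x y z where "x \<in> ?M - F" "y \<in> ?M - F" "z \<in> ?M - F"
       "incomparability (rel_of M \<phi>) x y" "incomparability (rel_of M \<phi>) y z"
       "\<not> incomparability (rel_of M \<phi>) x z"
      by blast
    then have "T x y z" unfolding T_def by (simp add: RM)
    then show ?thesis using \<open>x \<in> ?M - F\<close> \<open>y \<in> ?M - F\<close> \<open>z \<in> ?M - F\<close> sub by blast
  qed
  have rel: "dfn L N B (\<lambda>e. R (t e) (s e))" if "?M \<subseteq> B" "B \<subseteq> ?N" "dtm L N B t" "dtm L N B s" for B t s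
  proof -
    have "dfn L N B (\<lambda>e. rel_of N \<phi> (u e) (v e))" if "dtm L N B u" "dtm L N B v" for u v
      by (rule dfn_subst[OF N \<open>B \<subseteq> ?N\<close> dfn_mono[OF rel_of_dfn[OF \<phi>] \<open>?M \<subseteq> B\<close>] that])
    then show ?thesis unfolding R_def incomparability_def using that(3,4)
      by (intro dfn_neg dfn_disj)
  qed
  have T_dfn: "dfn L N B (\<lambda>e. T (t e) (s e) (u e))"
    if "?M \<subseteq> B" "B \<subseteq> ?N" "dtm L N B t" "dtm L N B s" "dtm L N B u" for B t s u
    unfolding T_def using that by (intro dfn_conj dfn_neg rel)
  have T1: "dfn L N B (\<lambda>e. \<exists>z\<in>?N. z \<notin> F \<and> T (e 0) (e 1) z)"
    if "?M \<subseteq> B" "B \<subseteq> ?N" "finite F" "F \<subseteq> ?M" for B F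
  proof -
    have "dfn L N B (\<lambda>e. e 2 \<notin> F \<and> T (e 0) (e 1) (e 2))"
      using that by (intro dfn_conj dfn_neg dfn_in_finite T_dfn dtm_var) auto
    from dfn_ex[OF this, of 2] show ?thesis by simp
  qed
  have T2: "dfn L N B (\<lambda>e. \<exists>y\<in>?N. y \<notin> F \<and> (\<exists>z\<in>?N. z \<notin> F \<and> T (e 0) y z))"
    if "?M \<subseteq> B" "B \<subseteq> ?N" "finite F" "F \<subseteq> ?M" for B F
  proof -
    have "dfn L N B (\<lambda>e. e 1 \<notin> F \<and> (\<exists>z\<in>?N. z \<notin> F \<and> T (e 0) (e 1) z))"
      using that by (intro dfn_conj dfn_neg dfn_in_finite T1 dtm_var) auto
    from dfn_ex[OF this, of 1] show ?thesis by simp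
  qed
  have infM: "infinite ?M" using M unfolding minimal_structure_def by auto
  \<comment> \<open>As M is infinite, adjoining an element already found leaves the parameter set
    small enough for the next use of saturation.\<close>
  have card_ins: "|insert a B| <o \<kappa>" if inf: "infinite B" and less: "|B| <o \<kappa>" for a and B :: "'a set"
  proof -
    obtain h where "bij_betw h B (B \<union> {a})"
      using infinite_imp_bij_betw2[OF inf] by blast
    then have "|B| =o |B \<union> {a}|" using card_of_ordIso by blast
    then have "|B \<union> {a}| =o |B|" by (rule ordIso_symmetric)
    then have "|B \<union> {a}| <o \<kappa>" using less by (rule ordIso_ordLess_trans)
    then show ?thesis by simp
  qed
  \<comment> \<open>The witnesses y and z must avoid F as well. Thus, once x is fixed, what is left
    for them is again a family of conditions indexed by finite sets.\<close>
  have "\<exists>x\<in>?N. x \<notin> ?M \<and> (\<forall>F. finite F \<and> F \<subseteq> ?M \<longrightarrow>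
      (\<exists>y\<in>?N. y \<notin> F \<and> (\<exists>z\<in>?N. z \<notin> F \<and> T x y z)))"
  proof (rule saturated_outside[where P = "\<lambda>F x. \<exists>y\<in>?N. y \<notin> F \<and> (\<exists>z\<in>?N. z \<notin> F \<and> T x y z)",
        OF sat sub card neN order_refl])
    show "\<exists>y\<in>?N. y \<notin> F \<and> (\<exists>z\<in>?N. z \<notin> F \<and> T x y z)"
      if "F \<subseteq> F'" "\<exists>y\<in>?N. y \<notin> F' \<and> (\<exists>z\<in>?N. z \<notin> F' \<and> T x y z)" for F F' x
      using that by blast
    show "dfn L N ?M (\<lambda>e. \<exists>y\<in>?N. y \<notin> F \<and> (\<exists>z\<in>?N. z \<notin> F \<and> T (e 0) y z))"
      if "finite F" "F \<subseteq> ?M" for F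
      using that by (rule T2[OF order_refl sub])
    show "\<exists>x\<in>?N. x \<notin> F \<and> (\<exists>y\<in>?N. y \<notin> F \<and> (\<exists>z\<in>?N. z \<notin> F \<and> T x y z))"
      if "finite F" "F \<subseteq> ?M" for F
      using that by (rule T_M)
  qed
  then obtain x where x: "x \<in> ?N" "x \<notin> ?M"
    "\<forall>F. finite F \<and> F \<subseteq> ?M \<longrightarrow> (\<exists>y\<in>?N. y \<notin> F \<and> (\<exists>z\<in>?N. z \<notin> F \<and> T x y z))"
    by (elim bexE conjE)
  let ?A = "insert x ?M"
  have A: "?M \<subseteq> ?A" "?A \<subseteq> ?N" "|?A| <o \<kappa>" using sub x(1) card_ins[OF infM card] by auto
  have T3: "dfn L N ?A (\<lambda>e. \<exists>z\<in>?N. z \<notin> F \<and> T x (e 0) z)" if "finite F" "F \<subseteq> ?M" for F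
  proof -
    have "dfn L N ?A (\<lambda>e. e 2 \<notin> F \<and> T x (e 0) (e 2))"
      using that A by (intro dfn_conj dfn_neg dfn_in_finite T_dfn dtm_var dtm_par) auto
    from dfn_ex[OF this, of 2] show ?thesis by simp
  qed
  have "\<exists>y\<in>?N. y \<notin> ?M \<and> (\<forall>F. finite F \<and> F \<subseteq> ?M \<longrightarrow> (\<exists>z\<in>?N. z \<notin> F \<and> T x y z))"
  proof (rule saturated_outside[where P = "\<lambda>F y. \<exists>z\<in>?N. z \<notin> F \<and> T x y z",
        OF sat A(2,3) neN A(1)])
    show "\<exists>z\<in>?N. z \<notin> F \<and> T x y z"
      if "F \<subseteq> F'" "\<exists>z\<in>?N. z \<notin> F' \<and> T x y z" for F F' y
      using that by blast
  qed (use T3 x(3) in simp_all)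
  then obtain y where y: "y \<in> ?N" "y \<notin> ?M"
    "\<forall>F. finite F \<and> F \<subseteq> ?M \<longrightarrow> (\<exists>z\<in>?N. z \<notin> F \<and> T x y z)"
    by (elim bexE conjE)
  let ?B = "insert y ?A"
  have infA: "infinite ?A" using infM by simp
  have B: "?M \<subseteq> ?B" "?B \<subseteq> ?N" "|?B| <o \<kappa>"
    using sub x(1) y(1) card_ins[OF infA A(3)] by auto
  have T4: "dfn L N ?B (\<lambda>e. T x y (e 0))"
    using B by (intro T_dfn dtm_var dtm_par) auto
  have "\<exists>z\<in>?N. z \<notin> ?M \<and> (\<forall>F. finite F \<and> F \<subseteq> ?M \<longrightarrow> T x y z)"
    by (rule saturated_outside[where P = "\<lambda>_. T x y", OF sat B(2,3) neN B(1)])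
      (use T4 y(3) in simp_all)
  then obtain z where z: "z \<in> ?N" "z \<notin> ?M" and T: "T x y z"
    by (metis empty_subsetI finite.emptyI)
  let ?P = "realizations N (generic_type L M)"
  have P: "x \<in> ?P" "y \<in> ?P" "z \<in> ?P"
    using outside_realizes_generic[OF M MN] x y z by auto
  have "equiv ?P {(x, y) \<in> ?P \<times> ?P. R x y}"
    using al unfolding almost_linear_order_def Let_def R_def by blast
  then have "trans {(x, y) \<in> ?P \<times> ?P. R x y}" unfolding equiv_def by blast
  then have "R x z" using T P unfolding T_def trans_def by blast
  then show False using T unfolding T_def by simp
qed


section \<open>Minimal groups\<close>

locale min_group = group G for G (structure) +
  fixes L :: "('f, 'r) lang" and M :: "('f, 'r, 'a) struct"
  assumes minimal: "minimal_group L M G"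
begin

section \<open>Definable sets and terms of a minimal group\<close>

abbreviation D :: "((nat \<Rightarrow> 'a) \<Rightarrow> bool) \<Rightarrow> bool" where "D \<equiv> dfn L M (carrier G)"
abbreviation T :: "((nat \<Rightarrow> 'a) \<Rightarrow> 'a) \<Rightarrow> bool" where "T \<equiv> dtm L M (carrier G)"

lemma univ_eq: "univ M = carrier G"
  using minimal unfolding minimal_group_def by simp

lemma minimal_M: "minimal_structure L M"
  using minimal unfolding minimal_group_def by simp

lemma struct_M: "is_struct L M"
  using minimal_M unfolding minimal_structure_def by simp

lemma infinite_carrier: "infinite (carrier G)"
  using minimal_M unfolding minimal_structure_def univ_eq by simp

lemma T_mult:
  assumes "T t" "T s"
  shows "T (\<lambda>e. t e \<otimes> s e)"
proof -
  obtain t' s' where t': "is_trm L (carrier G) t'" "\<And>e. range e \<subseteq> univ M \<Longrightarrow> val M e t' = t e"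
    and s': "is_trm L (carrier G) s'" "\<And>e. range e \<subseteq> univ M \<Longrightarrow> val M e s' = s e"
    using assms unfolding dtm_def by metis
  obtain m where m: "m \<in> fsyms L" "farity L m = 2"
    "\<And>x y. x \<in> univ M \<Longrightarrow> y \<in> univ M \<Longrightarrow> fint M m [x, y] = x \<otimes> y"
    using minimal unfolding minimal_group_def by blast
  have in_univ: "val M e r \<in> univ M" if "range e \<subseteq> univ M" "is_trm L (carrier G) r" for e r
    using val_in_univ[OF struct_M _ that(2,1)] univ_eq by simp
  have "val M e (App m [t', s']) = t e \<otimes> s e" if "range e \<subseteq> univ M" for e
    using m(3) in_univ[OF that t'(1)] in_univ[OF that s'(1)] t'(2)[OF that] s'(2)[OF that] by simp
  moreover have "is_trm L (carrier G) (App m [t', s'])" using m t' s' by simp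
  ultimately show ?thesis unfolding dtm_def by blast
qed

lemma T_par: "a \<in> carrier G \<Longrightarrow> T (\<lambda>e. a)"
  by (rule dtm_par)

lemma T_pow: "T t \<Longrightarrow> T (\<lambda>e. t e [^] (n::nat))"
  by (induction n) (auto intro: T_mult T_par)

lemmas D_ex = dfn_ex[of L M "carrier G", unfolded univ_eq]
lemmas D_all = dfn_all[of L M "carrier G", unfolded univ_eq]

lemma D_subst: "D (\<lambda>e. R (e 0) (e 1)) \<Longrightarrow> T t \<Longrightarrow> T s \<Longrightarrow> D (\<lambda>e. R (t e) (s e))"
  by (rule dfn_subst[OF struct_M]) (auto simp: univ_eq)

lemma D_dichotomy:
  assumes "D (\<lambda>e. Q (e 0))"
  shows "finite {x \<in> carrier G. Q x} \<or> finite {x \<in> carrier G. \<not> Q x}"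
  using minimal_structure_dfn[OF minimal_M, of Q] assms by (simp add: univ_eq)

lemma outside_finite:
  assumes "finite F" obtains x where "x \<in> carrier G" "x \<notin> F"
  using assms infinite_carrier by (meson finite_subset subsetI)

lemma finite_preimage_mult:
  assumes "finite W" "g \<in> carrier G"
  shows "finite {x \<in> carrier G. x \<otimes> g \<in> W}"
proof (rule finite_imageD)
  show "finite ((\<lambda>x. x \<otimes> g) ` {x \<in> carrier G. x \<otimes> g \<in> W})"
    by (rule finite_subset[OF _ assms(1)]) auto
  show "inj_on (\<lambda>x. x \<otimes> g) {x \<in> carrier G. x \<otimes> g \<in> W}"
    using assms(2) by (auto simp: inj_on_def)
qed

end


section \<open>Definable preorders with finite classes\<close>

locale min_comm_group = min_group + comm_group
begin

definition preord :: "('a \<Rightarrow> 'a \<Rightarrow> bool) \<Rightarrow> bool" where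
  "preord lq \<longleftrightarrow> D (\<lambda>e. lq (e 0) (e 1)) \<and>
     (\<forall>x\<in>carrier G. \<forall>y\<in>carrier G. lq x y \<or> lq y x) \<and>
     (\<forall>x\<in>carrier G. \<forall>y\<in>carrier G. \<forall>z\<in>carrier G. lq x y \<longrightarrow> lq y z \<longrightarrow> lq x z) \<and>
     (\<forall>b\<in>carrier G. finite {x \<in> carrier G. lq x b \<and> lq b x})"

abbreviation seg :: "('a \<Rightarrow> 'a \<Rightarrow> bool) \<Rightarrow> 'a \<Rightarrow> 'a set" where
  "seg lq b \<equiv> {x \<in> carrier G. lq x b}"

text \<open>By minimality an initial segment is finite or cofinite; this set collects the elements
  for which counting is possible.\<close>

definition low :: "('a \<Rightarrow> 'a \<Rightarrow> bool) \<Rightarrow> 'a set" where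
  "low lq = {b \<in> carrier G. finite (seg lq b)}"

lemma preordD:
  assumes "preord lq"
  shows "D (\<lambda>e. lq (e 0) (e 1))"
    and "\<And>x y. x \<in> carrier G \<Longrightarrow> y \<in> carrier G \<Longrightarrow> lq x y \<or> lq y x"
    and "\<And>x y z. x \<in> carrier G \<Longrightarrow> y \<in> carrier G \<Longrightarrow> z \<in> carrier G \<Longrightarrow> lq x y \<Longrightarrow> lq y z \<Longrightarrow> lq x z"
    and "\<And>b. b \<in> carrier G \<Longrightarrow> finite {x \<in> carrier G. lq x b \<and> lq b x}"
  using assms unfolding preord_def by blast+

lemma D_preord: "preord lq \<Longrightarrow> T t \<Longrightarrow> T s \<Longrightarrow> D (\<lambda>e. lq (t e) (s e))"
  by (rule D_subst[where R = lq, OF preordD(1)])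

lemma preord_refl: "preord lq \<Longrightarrow> x \<in> carrier G \<Longrightarrow> lq x x"
  using preordD(2) by blast

lemma preord_converse: "preord lq \<Longrightarrow> preord (\<lambda>x y. lq y x)"
proof -
  assume lq: "preord lq"
  have "D (\<lambda>e. lq (e 1) (e 0))"
    by (intro D_preord[OF lq] dtm_var)
  moreover have "finite {x \<in> carrier G. lq b x \<and> lq x b}" if "b \<in> carrier G" for b
    using preordD(4)[OF lq that] by (simp add: conj_commute)
  moreover have "lq z x" if "x \<in> carrier G" "y \<in> carrier G" "z \<in> carrier G" "lq y x" "lq z y" for x y z
    using preordD(3)[OF lq] that by blast
  ultimately show ?thesis
    using preordD(2)[OF lq] unfolding preord_def by blast
qed

lemma preord_max:
  assumes lq: "preord lq" and "finite A" "A \<noteq> {}" "A \<subseteq> carrier G"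
  shows "\<exists>m\<in>A. \<forall>x\<in>A. lq x m"
  using assms(2-4)
proof (induction A rule: finite_ne_induct)
  case (singleton x)
  then show ?case using preord_refl[OF lq] by simp
next
  case (insert x F)
  then obtain m where m: "m \<in> F" "\<forall>y\<in>F. lq y m" by auto
  have c: "x \<in> carrier G" "m \<in> carrier G" "F \<subseteq> carrier G" using insert.prems m(1) by auto
  show ?case
  proof (cases "lq x m")
    case True
    then show ?thesis using m by blast
  next
    case False
    then have "lq m x" using preordD(2)[OF lq] c by blast
    then have "\<forall>y\<in>F. lq y x" using m(2) preordD(3)[OF lq] c by blast
    then show ?thesis using preord_refl[OF lq] c by blast
  qed
qed

text \<open>The largest of n + 1 elements of \<open>low lq\<close> has all of them in its
  segment.\<close>

lemma unbounded_segments: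
  assumes lq: "preord lq" and inf: "infinite (low lq)"
  obtains b where "b \<in> low lq" "n < card (seg lq b)"
proof -
  obtain A where A: "A \<subseteq> low lq" "finite A" "card A = Suc n"
    using infinite_arbitrarily_large[OF inf] by blast
  have "A \<noteq> {}" using A(3) by auto
  moreover have "A \<subseteq> carrier G" using A(1) by (auto simp: low_def)
  ultimately obtain b where b: "b \<in> A" "\<forall>x\<in>A. lq x b"
    using preord_max[OF lq A(2)] by blast
  have "A \<subseteq> seg lq b" using b(2) \<open>A \<subseteq> carrier G\<close> by blast
  moreover have "b \<in> low lq" using A(1) b(1) by blast
  moreover from this have "finite (seg lq b)" by (simp add: low_def)
  ultimately have "card A \<le> card (seg lq b)" by (meson card_mono)
  then show ?thesis using that[OF \<open>b \<in> low lq\<close>] A(3) by simp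
qed

text \<open>If translation by a increased almost all elements, so would translation by an n-th root
  of a, and n elements would leave a finite initial segment under translation by a; but as many
  elements enter it, and these lie in a finite set that does not depend on n.\<close>

lemma finite_increasing_translation:
  assumes lq: "preord lq" and inf: "infinite (low lq)"
    and sq: "\<And>x. x \<in> carrier G \<Longrightarrow> \<exists>y\<in>carrier G. y [^] (2::nat) = x"
    and a: "a \<in> carrier G"
  shows "finite {x \<in> carrier G. \<not> lq (x \<otimes> a) x}"
proof (rule ccontr)
  assume infa: "infinite {x \<in> carrier G. \<not> lq (x \<otimes> a) x}"
  have dich: "finite {x \<in> carrier G. lq (x \<otimes> g) x} \<or> finite {x \<in> carrier G. \<not> lq (x \<otimes> g) x}"
    if "g \<in> carrier G" for g
    by (rule D_dichotomy[where Q = "\<lambda>x. lq (x \<otimes> g) x"])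
      (intro D_preord[OF lq] T_mult T_par dtm_var that)
  define E where "E = {x \<in> carrier G. lq (x \<otimes> a) x}"
  have finE: "finite E" using dich[OF a] infa unfolding E_def by blast
  have roots: "\<exists>c\<in>carrier G. c [^] ((2::nat) ^ k) = a" for k
  proof (induction k)
    case 0
    then show ?case using a by auto
  next
    case (Suc k)
    then obtain c where c: "c \<in> carrier G" "c [^] ((2::nat) ^ k) = a" by blast
    then obtain d where "d \<in> carrier G" "d [^] (2::nat) = c" using sq by blast
    then have "d [^] ((2::nat) ^ Suc k) = a" using c(2) by (simp add: nat_pow_pow flip: c(2) \<open>d [^] (2::nat) = c\<close>)
    then show ?case using \<open>d \<in> carrier G\<close> by blast
  qed
  \<comment> \<open>The count below needs n to exceed \<open>card E\<close>; a power of 2 is chosen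
    because iterated square roots of a provide an n-th root.\<close>
  define n :: nat where "n = 2 ^ card E"
  have n: "card E < n" unfolding n_def by simp
  obtain c where c: "c \<in> carrier G" "c [^] n = a" using roots unfolding n_def by blast
  define W where "W = {x \<in> carrier G. lq (x \<otimes> c) x}"
  have finW: "finite W"
  proof (rule ccontr)
    assume "infinite W"
    then have fin: "finite {x \<in> carrier G. \<not> lq (x \<otimes> c) x}" (is "finite ?V")
      using dich[OF c(1)] unfolding W_def by blast
    \<comment> \<open>Outside this finite set none of the n steps of translation by c increases the
      element reached so far. Hence the whole translation by a does not increase x either, which
      means that x is in E.\<close>
    have "finite (E \<union> (\<Union>i<n. {x \<in> carrier G. x \<otimes> c [^] i \<in> ?V}))"
      using finE finite_preimage_mult[OF fin] c(1) by auto
    then obtain x where x: "x \<in> carrier G" "x \<notin> E \<union> (\<Union>i<n. {x \<in> carrier G. x \<otimes> c [^] i \<in> ?V})"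
      by (rule outside_finite)
    have xV: "x \<otimes> c [^] i \<notin> ?V" if "i < n" for i
      using x that by simp
    have "lq (x \<otimes> c [^] i) x" if "i \<le> n" for i
      using that
    proof (induction i)
      case 0
      then show ?case using x(1) preord_refl[OF lq] by simp
    next
      case (Suc i)
      have "lq (x \<otimes> c [^] i \<otimes> c) (x \<otimes> c [^] i)" using x(1) xV[of i] Suc.prems c(1) by auto
      then have "lq (x \<otimes> c [^] Suc i) (x \<otimes> c [^] i)" using x(1) c(1) by (simp add: m_assoc)
      then show ?case using Suc preordD(3)[OF lq] x(1) c(1) by (meson Suc_leD m_closed nat_pow_closed)
    qed
    from this[of n] have "x \<in> E" using c(2) x(1) unfolding E_def by simp
    with x(2) show False by simp
  qed
  \<comment> \<open>b is chosen so that the 2n points from b divided by a up to the last one before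
    b times a all lie outside W. The sequence y then increases strictly and passes through b at the
    index n.\<close>
  have "finite (\<Union>i<2*n. {b \<in> carrier G. b \<otimes> (inv (c [^] n) \<otimes> c [^] i) \<in> W})"
    using finite_preimage_mult[OF finW] c(1) by auto
  then have "\<not> low lq \<subseteq> (\<Union>i<2*n. {b \<in> carrier G. b \<otimes> (inv (c [^] n) \<otimes> c [^] i) \<in> W})"
    using inf finite_subset by blast
  then obtain b where b: "b \<in> low lq" "b \<notin> (\<Union>i<2*n. {b \<in> carrier G. b \<otimes> (inv (c [^] n) \<otimes> c [^] i) \<in> W})"
    by blast
  have bc: "b \<in> carrier G" and finS: "finite (seg lq b)" using b(1) by (auto simp: low_def)
  define y where "y i = b \<otimes> inv (c [^] n) \<otimes> c [^] i" for i :: nat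
  have yc: "y i \<in> carrier G" for i using bc c(1) by (simp add: y_def)
  have step: "\<not> lq (y (Suc i)) (y i)" if "i < 2*n" for i
    using b(2) that bc c(1) yc[of i] by (simp add: W_def y_def m_assoc)
  have less: "\<not> lq (y j) (y i)" if "i < j" "j \<le> 2*n" for i j
    using that
  proof (induction j)
    case (Suc j)
    show ?case
    proof (cases "i = j")
      case True
      then show ?thesis using step Suc.prems by simp
    next
      case False
      then have "\<not> lq (y j) (y i)" using Suc by simp
      then show ?thesis using step[of j] Suc.prems preordD(2,3)[OF lq] yc
        by (meson Suc_le_lessD)
    qed
  qed simp
  have yn: "y n = b" using bc c(1) by (simp add: y_def m_assoc)
  let ?S = "seg lq b" and ?f = "\<lambda>x. x \<otimes> a"
  let ?O = "{x \<in> ?S. x \<otimes> a \<notin> ?S}" and ?I = "{x \<in> carrier G. x \<notin> ?S \<and> x \<otimes> a \<in> ?S}"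
  have injf: "inj_on ?f (carrier G)" using a by (auto simp: inj_on_def)
  have y_a: "y i \<otimes> a = y (i + n)" for i
    using bc c by (simp add: y_def m_assoc nat_pow_mult flip: c(2))
  \<comment> \<open>Translation by a shifts the index by n: y 1, ..., y n are at most b, and their
    translates y (n+1), ..., y (2n) are above b.\<close>
  have "y ` {1..n} \<subseteq> ?O"
  proof
    fix z assume "z \<in> y ` {1..n}"
    then obtain i where i: "z = y i" "1 \<le> i" "i \<le> n" by auto
    have "lq (y i) b"
    proof (cases "i = n")
      case True
      then show ?thesis using yn preord_refl[OF lq] bc by simp
    next
      case False
      then have "\<not> lq (y n) (y i)" using i less[of i n] by simp
      then show ?thesis using preordD(2)[OF lq] yc yn bc by metis
    qed
    moreover have "\<not> lq (y (i + n)) b" using less[of n "i + n"] i yn by simp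
    ultimately show "z \<in> ?O" using i yc y_a by simp
  qed
  moreover have "inj_on y {1..n}"
  proof (rule linorder_inj_onI)
    fix i j :: nat assume "i < j" "i \<in> {1..n}" "j \<in> {1..n}"
    then have "\<not> lq (y j) (y i)" using less[of i j] by simp
    then show "y i \<noteq> y j" using preord_refl[OF lq yc[of i]] by metis
  qed auto
  moreover have "finite ?O" by (rule finite_subset[OF _ finS]) auto
  ultimately have "n \<le> card ?O" using card_inj_on_le[of y "{1..n}" ?O] by simp
  \<comment> \<open>\<open>?f\<close> is injective and the segment finite, so the segment and its
    image exceed each other by equally many elements; this turns the elements that leave into those
    that enter.\<close>
  also have "card ?O = card (?f ` ?O)"
    by (rule card_image[symmetric]) (rule inj_on_subset[OF injf], auto)
  also have "?f ` ?O = ?f ` ?S - ?S" by auto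
  also have "card (?f ` ?S - ?S) = card (?f ` ?S) - card (?f ` ?S \<inter> ?S)"
    using finS by (simp add: card_Diff_subset_Int)
  also have "card (?f ` ?S) = card ?S"
    by (rule card_image) (rule inj_on_subset[OF injf], auto)
  also have "card ?S - card (?f ` ?S \<inter> ?S) = card (?S - ?f ` ?S)"
    using finS by (simp add: card_Diff_subset_Int Int_commute)
  also have "?S - ?f ` ?S = ?f ` ?I"
  proof
    show "?S - ?f ` ?S \<subseteq> ?f ` ?I"
    proof
      fix z assume z: "z \<in> ?S - ?f ` ?S"
      then have "z \<otimes> inv a \<in> carrier G" "z \<otimes> inv a \<otimes> a = z" using a by (auto simp: m_assoc)
      moreover from this have "z \<otimes> inv a \<notin> ?S" using z by (metis (no_types, lifting) Diff_iff image_eqI)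
      ultimately show "z \<in> ?f ` ?I" using z by (intro image_eqI[of _ _ "z \<otimes> inv a"]) auto
    qed
    show "?f ` ?I \<subseteq> ?S - ?f ` ?S" using a by auto
  qed
  also have "card (?f ` ?I) = card ?I"
    by (rule card_image) (rule inj_on_subset[OF injf], auto)
  \<comment> \<open>An element that enters moves from above b to at most b, so translation by a does
    not increase it.\<close>
  also have "?I \<subseteq> E"
  proof
    fix z assume z: "z \<in> ?I"
    then have "lq b z" using preordD(2)[OF lq, of z b] bc by simp
    then have "lq (z \<otimes> a) z" using preordD(3)[OF lq, of "z \<otimes> a" b z] z bc by simp
    then show "z \<in> E" using z by (simp add: E_def)
  qed
  then have "card ?I \<le> card E" using finE card_mono by blast
  finally show False using n by simp
qed

text \<open>The bound for the inverse of a, read at \<open>x \<otimes> a\<close>, is the missing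
  inequality.\<close>

lemma finite_moved_by_translation:
  assumes lq: "preord lq" and inf: "infinite (low lq)"
    and sq: "\<And>x. x \<in> carrier G \<Longrightarrow> \<exists>y\<in>carrier G. y [^] (2::nat) = x"
    and a: "a \<in> carrier G"
  shows "finite {x \<in> carrier G. \<not> (lq (x \<otimes> a) x \<and> lq x (x \<otimes> a))}"
proof -
  have "finite {x \<in> carrier G. \<not> lq (x \<otimes> inv a) x}" (is "finite ?A")
    by (rule finite_increasing_translation[OF lq inf sq]) (use a in auto)
  then have "finite {x \<in> carrier G. x \<otimes> a \<in> ?A}" using a by (rule finite_preimage_mult)
  moreover have "finite {x \<in> carrier G. \<not> lq (x \<otimes> a) x}"
    by (rule finite_increasing_translation[OF lq inf sq a])
  moreover have "{x \<in> carrier G. \<not> (lq (x \<otimes> a) x \<and> lq x (x \<otimes> a))} \<subseteq>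
     {x \<in> carrier G. x \<otimes> a \<in> ?A} \<union> {x \<in> carrier G. \<not> lq (x \<otimes> a) x}"
    using a by (auto simp: m_assoc)
  ultimately show ?thesis by (meson finite_UnI finite_subset)
qed

text \<open>If b is equivalent to no element moved by a, then all \<open>b \<otimes> a [^] i\<close>
  stay in the class of b. That class is finite, so two powers of a coincide.\<close>

lemma torsion_of_preord:
  assumes lq: "preord lq" and inf: "infinite (low lq)"
    and sq: "\<And>x. x \<in> carrier G \<Longrightarrow> \<exists>y\<in>carrier G. y [^] (2::nat) = x"
    and a: "a \<in> carrier G"
  shows "\<exists>n::nat. n > 0 \<and> a [^] n = \<one>"
proof -
  define E where "E = {x \<in> carrier G. \<not> (lq (x \<otimes> a) x \<and> lq x (x \<otimes> a))}"
  have "finite E" unfolding E_def by (rule finite_moved_by_translation[OF assms])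
  then have "finite (\<Union>e\<in>E. {x \<in> carrier G. lq x e \<and> lq e x})"
    using preordD(4)[OF lq] by (auto simp: E_def)
  then obtain b where b0: "b \<in> carrier G" "b \<notin> (\<Union>e\<in>E. {x \<in> carrier G. lq x e \<and> lq e x})"
    by (rule outside_finite)
  then have b: "b \<in> carrier G" "\<And>e. e \<in> E \<Longrightarrow> \<not> (lq b e \<and> lq e b)" by simp_all
  have "lq (b \<otimes> a [^] i) b \<and> lq b (b \<otimes> a [^] i)" for i :: nat
  proof (induction i)
    case 0
    then show ?case using b(1) preord_refl[OF lq] by simp
  next
    case (Suc i)
    have c: "b \<otimes> a [^] i \<in> carrier G" "b \<otimes> a [^] i \<otimes> a \<in> carrier G" using a b(1) by auto
    have "b \<otimes> a [^] i \<notin> E" using b(2) Suc by blast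
    then have "lq (b \<otimes> a [^] i \<otimes> a) (b \<otimes> a [^] i)" "lq (b \<otimes> a [^] i) (b \<otimes> a [^] i \<otimes> a)"
      using c unfolding E_def by auto
    then have "lq (b \<otimes> a [^] i \<otimes> a) b" "lq b (b \<otimes> a [^] i \<otimes> a)"
      using Suc preordD(3)[OF lq] b(1) c by blast+
    then show ?case using a b(1) by (simp add: m_assoc)
  qed
  then have "range (\<lambda>i::nat. b \<otimes> a [^] i) \<subseteq> {x \<in> carrier G. lq x b \<and> lq b x}" using a b(1) by auto
  then have "finite (range (\<lambda>i::nat. b \<otimes> a [^] i))" using preordD(4)[OF lq b(1)] finite_subset by blast
  then have "\<not> inj (\<lambda>i::nat. b \<otimes> a [^] i)" using finite_imageD infinite_UNIV_nat by blast
  then obtain i j :: nat where ij: "i < j" "b \<otimes> a [^] i = b \<otimes> a [^] j"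
    unfolding inj_def by (metis linorder_neqE_nat)
  then have "a [^] i = a [^] j" using a b(1) by simp
  also have "\<dots> = a [^] i \<otimes> a [^] (j - i)" using a ij(1) by (simp add: nat_pow_mult)
  finally have "a [^] (j - i) = \<one>" using a l_cancel_one'[of "a [^] i" "a [^] (j - i)"] by simp
  then show ?thesis using ij(1) by (intro exI[of _ "j - i"]) simp
qed

text \<open>If x were at most its p-th power outside a finite set E, all p-th roots of elements of a
  segment S would lie in S or E. Each element has at least two such roots, as the kernel is
  nontrivial; so S could have at most \<open>card E\<close> elements, but segments are arbitrarily
  large.\<close>

lemma finite_power_not_descending:
  assumes lq: "preord lq" and inf: "infinite (low lq)"
    and surj: "\<And>x. x \<in> carrier G \<Longrightarrow> \<exists>y\<in>carrier G. y [^] (p::nat) = x"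
    and z: "z \<in> carrier G" "z \<noteq> \<one>" "z [^] p = \<one>"
  shows "finite {x \<in> carrier G. lq x (x [^] p)}"
proof (rule ccontr)
  assume *: "infinite {x \<in> carrier G. lq x (x [^] p)}"
  define E where "E = {x \<in> carrier G. \<not> lq x (x [^] p)}"
  have "finite {x \<in> carrier G. lq x (x [^] p)} \<or> finite E"
    unfolding E_def
    by (rule D_dichotomy[where Q = "\<lambda>x. lq x (x [^] p)"])
      (intro D_preord[OF lq] T_pow dtm_var)
  with * have finE: "finite E" by blast
  obtain b where b: "b \<in> low lq" "card E < card (seg lq b)"
    using unbounded_segments[OF lq inf] by blast
  let ?S = "seg lq b"
  have bc: "b \<in> carrier G" and finS: "finite ?S" using b(1) by (auto simp: low_def)
  \<comment> \<open>\<open>r x\<close> and \<open>r x \<otimes> z\<close> are two different p-th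
    roots of x; the images of the segment under the two choices are disjoint.\<close>
  obtain r where r: "\<And>x. x \<in> carrier G \<Longrightarrow> r x \<in> carrier G" "\<And>x. x \<in> carrier G \<Longrightarrow> r x [^] p = x"
    using surj by metis
  let ?R = "\<lambda>x. r x \<otimes> z"
  have R: "?R x [^] p = x" "?R x \<in> carrier G" if "x \<in> carrier G" for x
    using that z r by (simp_all add: nat_pow_distrib)
  have "inj_on r ?S" by (rule inj_on_inverseI[of _ "\<lambda>x. x [^] p"]) (simp add: r)
  moreover have "inj_on ?R ?S" by (rule inj_on_inverseI[of _ "\<lambda>x. x [^] p"]) (simp add: R)
  moreover have "r ` ?S \<inter> ?R ` ?S = {}"
  proof (rule ccontr)
    assume "r ` ?S \<inter> ?R ` ?S \<noteq> {}"
    then obtain x y where xy: "x \<in> carrier G" "y \<in> carrier G" "r x = ?R y" by auto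
    then have "x = y" using r(2) R(1) by metis
    then have "r x = r x \<otimes> z" using xy(3) by simp
    then have "z = \<one>" using l_cancel_one'[OF r(1)[OF xy(1)] z(1)] by blast
    then show False using z(2) by simp
  qed
  ultimately have two: "card (r ` ?S \<union> ?R ` ?S) = card ?S + card ?S"
    using finS by (simp add: card_Un_disjoint card_image)
  have pre: "x \<in> ?S \<union> E" if "x \<in> carrier G" "x [^] p \<in> ?S" for x
    using that preordD(3)[OF lq, of x "x [^] p" b] bc unfolding E_def by auto
  have "r ` ?S \<union> ?R ` ?S \<subseteq> ?S \<union> E"
  proof
    fix y assume "y \<in> r ` ?S \<union> ?R ` ?S"
    then obtain x where x: "x \<in> ?S" "y = r x \<or> y = ?R x" by blast
    then have "y \<in> carrier G" "y [^] p = x" using r R by auto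
    with x(1) show "y \<in> ?S \<union> E" by (intro pre) auto
  qed
  then have "card (r ` ?S \<union> ?R ` ?S) \<le> card (?S \<union> E)"
    using finS finE by (intro card_mono) auto
  also have "card (?S \<union> E) \<le> card ?S + card E" by (rule card_Un_le)
  finally show False using b(2) two by simp
qed

text \<open>Otherwise the descent of p-th powers would hold for the order and for its converse, so
  almost every p-th power would be both strictly below and strictly above its base.\<close>

lemma low_cofinite:
  assumes lq: "preord lq" and inf: "infinite (low lq)"
    and surj: "\<And>x. x \<in> carrier G \<Longrightarrow> \<exists>y\<in>carrier G. y [^] (p::nat) = x"
    and z: "z \<in> carrier G" "z \<noteq> \<one>" "z [^] p = \<one>"
  shows "finite (carrier G - low lq)"
proof (rule ccontr)
  assume *: "infinite (carrier G - low lq)"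
  \<comment> \<open>An infinite segment is cofinite, so only finitely many elements lie strictly
    above b, and the class of b adds finitely many more.\<close>
  have "carrier G - low lq \<subseteq> low (\<lambda>x y. lq y x)"
  proof
    fix b assume b: "b \<in> carrier G - low lq"
    have "finite {x \<in> carrier G. lq x b} \<or> finite {x \<in> carrier G. \<not> lq x b}"
      by (rule D_dichotomy[where Q = "\<lambda>x. lq x b"])
       (use b in \<open>intro D_preord[OF lq] T_par dtm_var; simp\<close>)
    then have "finite {x \<in> carrier G. \<not> lq x b}" using b by (auto simp: low_def)
    then have "finite ({x \<in> carrier G. \<not> lq x b} \<union> {x \<in> carrier G. lq x b \<and> lq b x})"
      using preordD(4)[OF lq] b by auto
    then have "finite {x \<in> carrier G. lq b x}" by (rule finite_subset[rotated]) auto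
    then show "b \<in> low (\<lambda>x y. lq y x)" using b by (simp add: low_def)
  qed
  with * have "infinite (low (\<lambda>x y. lq y x))" using finite_subset by blast
  from finite_power_not_descending[OF preord_converse[OF lq] this surj z]
  have "finite {x \<in> carrier G. lq (x [^] p) x}" .
  moreover have "finite {x \<in> carrier G. lq x (x [^] p)}"
    by (rule finite_power_not_descending[OF lq inf surj z])
  ultimately have "finite ({x \<in> carrier G. lq (x [^] p) x} \<union> {x \<in> carrier G. lq x (x [^] p)})"
    by simp
  then obtain x where "x \<in> carrier G"
    "x \<notin> {x \<in> carrier G. lq (x [^] p) x} \<union> {x \<in> carrier G. lq x (x [^] p)}"
    by (rule outside_finite)
  then show False using preordD(2)[OF lq] by blast
qed

text \<open>The exceptional elements become one class below everything else, and membership in F is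
  definable because F is finite. This serves for the elements that spoil transitivity and for those
  with infinite segments.\<close>

lemma preord_bottom:
  assumes F: "finite F" "F \<subseteq> carrier G" and def_le: "D (\<lambda>e. lq (e 0) (e 1))"
    and total: "\<And>x y. x \<in> carrier G - F \<Longrightarrow> y \<in> carrier G - F \<Longrightarrow> lq x y \<or> lq y x"
    and trans: "\<And>x y z. x \<in> carrier G - F \<Longrightarrow> y \<in> carrier G - F \<Longrightarrow> z \<in> carrier G - F \<Longrightarrow>
      lq x y \<Longrightarrow> lq y z \<Longrightarrow> lq x z"
    and fin: "\<And>b. b \<in> carrier G - F \<Longrightarrow> finite {x \<in> carrier G - F. lq x b \<and> lq b x}"
  shows "preord (\<lambda>x y. x \<in> F \<or> y \<notin> F \<and> lq x y)" (is "preord ?lq")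
  unfolding preord_def
proof (intro conjI ballI impI)
  show "D (\<lambda>e. e 0 \<in> F \<or> e 1 \<notin> F \<and> lq (e 0) (e 1))"
    using F by (intro dfn_disj dfn_conj dfn_neg dfn_in_finite dtm_var def_le)
  show "?lq x y \<or> ?lq y x" if "x \<in> carrier G" "y \<in> carrier G" for x y
    using total that by blast
  show "?lq x z" if "x \<in> carrier G" "y \<in> carrier G" "z \<in> carrier G" "?lq x y" "?lq y z" for x y z
    using trans[of x y z] that by blast
  show "finite {x \<in> carrier G. ?lq x b \<and> ?lq b x}" if "b \<in> carrier G" for b
  proof (cases "b \<in> F")
    case True
    then show ?thesis using F(1) by (rule_tac finite_subset[of _ F]) auto
  next
    case False
    then have "{x \<in> carrier G. ?lq x b \<and> ?lq b x} \<subseteq> {x \<in> carrier G - F. lq x b \<and> lq b x} \<union> F"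
      by auto
    then show ?thesis using fin[of b] that False F(1) by (meson DiffI finite_UnI finite_subset)
  qed
qed

text \<open>In the preorder given by the definable chain of finite subgroups \<open>{a. h a x}\<close>, both
  \<open>x [^] p\<close> and \<open>x [^] q\<close> lie below x for almost all x, although x is a product of their powers.\<close>

lemma at_most_one_prime:
  assumes lq: "preord lq" and segs: "\<And>b. b \<in> carrier G \<Longrightarrow> finite (seg lq b)"
    and moved: "\<And>a. a \<in> carrier G \<Longrightarrow> finite {x \<in> carrier G. \<not> (lq (x \<otimes> a) x \<and> lq x (x \<otimes> a))}"
    and torsion: "\<And>a. a \<in> carrier G \<Longrightarrow> \<exists>n::nat. n > 0 \<and> a [^] n = \<one>"
    and "coprime p q"
    and surj_p: "\<And>x. x \<in> carrier G \<Longrightarrow> \<exists>y\<in>carrier G. y [^] (p::nat) = x"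
    and surj_q: "\<And>x. x \<in> carrier G \<Longrightarrow> \<exists>y\<in>carrier G. y [^] (q::nat) = x"
    and z: "z \<in> carrier G" "z \<noteq> \<one>" "z [^] p = \<one>"
    and w: "w \<in> carrier G" "w \<noteq> \<one>" "w [^] q = \<one>"
  shows False
proof -
  \<comment> \<open>\<open>h a x\<close> says that translation by a keeps every element from x
    upward in its class. For fixed x such a are closed under products and finite in number, and
    there are more of them as x grows.\<close>
  define h where "h a x \<longleftrightarrow> (\<forall>y\<in>carrier G. lq x y \<longrightarrow> lq (y \<otimes> a) y \<and> lq y (y \<otimes> a))" for a x
  \<comment> \<open>a is at most b if a belongs to every member of the chain that contains
    b.\<close>
  define lq' where "lq' a b \<longleftrightarrow> (\<forall>x\<in>carrier G. h b x \<longrightarrow> h a x)" for a b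
  note tot = preordD(2)[OF lq] and tr = preordD(3)[OF lq]
  have D_le: "D (\<lambda>e. lq (t e) (s e))" if "T t" "T s" for t s
    by (rule D_preord[OF lq that])
  have "D (\<lambda>e. lq (e 1) (e 2) \<longrightarrow> lq (e 2 \<otimes> e 0) (e 2) \<and> lq (e 2) (e 2 \<otimes> e 0))"
    by (intro dfn_imp dfn_conj D_le T_mult dtm_var)
  from D_all[OF this, of 2] have D_h0: "D (\<lambda>e. h (e 0) (e 1))"
    unfolding h_def by simp
  have D_h: "D (\<lambda>e. h (t e) (s e))" if "T t" "T s" for t s
    by (rule D_subst[where R = h, OF D_h0 that])
  have "D (\<lambda>e. h (e 1) (e 2) \<longrightarrow> h (e 0) (e 2))"
    by (intro dfn_imp D_h dtm_var)
  from D_all[OF this, of 2] have D_le': "D (\<lambda>e. lq' (e 0) (e 1))"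
    unfolding lq'_def by simp
  have h_mono: "h a x'" if "h a x" "lq x x'" "x \<in> carrier G" "x' \<in> carrier G" for a x x'
    using that tr unfolding h_def by blast
  have h_ex: "\<exists>x\<in>carrier G. h a x" if a: "a \<in> carrier G" for a
  proof -
    let ?E = "{x \<in> carrier G. \<not> (lq (x \<otimes> a) x \<and> lq x (x \<otimes> a))}"
    \<comment> \<open>An x outside the segments of all moved elements has no moved element above
      it.\<close>
    have "finite (\<Union>e\<in>?E. seg lq e)" using moved[OF a] segs by auto
    then obtain x where "x \<in> carrier G" "x \<notin> (\<Union>e\<in>?E. seg lq e)" by (rule outside_finite)
    then have "h a x" unfolding h_def by blast
    then show ?thesis using \<open>x \<in> carrier G\<close> by blast
  qed
  have h_fin: "finite {a \<in> carrier G. h a x}" if x: "x \<in> carrier G" for x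
  proof (rule finite_imageD)
    show "finite ((\<lambda>a. x \<otimes> a) ` {a \<in> carrier G. h a x})"
      by (rule finite_subset[OF _ segs[OF x]]) (use x preord_refl[OF lq x] in \<open>auto simp: h_def\<close>)
    show "inj_on (\<lambda>a. x \<otimes> a) {a \<in> carrier G. h a x}" using x by (auto simp: inj_on_def)
  qed
  have h_mult: "h (a \<otimes> b) x" if "h a x" "h b x" "a \<in> carrier G" "b \<in> carrier G" "x \<in> carrier G" for a b x
    unfolding h_def
  proof (intro ballI impI)
    fix y assume y: "y \<in> carrier G" "lq x y"
    have c: "y \<otimes> a \<in> carrier G" "y \<otimes> a \<otimes> b \<in> carrier G" using y that by auto
    have 1: "lq (y \<otimes> a) y" "lq y (y \<otimes> a)" using y that unfolding h_def by auto
    then have "lq x (y \<otimes> a)" using tr[OF that(5) y(1) c(1)] y by blast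
    then have 2: "lq (y \<otimes> a \<otimes> b) (y \<otimes> a)" "lq (y \<otimes> a) (y \<otimes> a \<otimes> b)" using c that unfolding h_def by auto
    have "lq (y \<otimes> a \<otimes> b) y" "lq y (y \<otimes> a \<otimes> b)"
      using tr[OF c(2,1) y(1) 2(1) 1(1)] tr[OF y(1) c 1(2) 2(2)] by auto
    then show "lq (y \<otimes> (a \<otimes> b)) y \<and> lq y (y \<otimes> (a \<otimes> b))" using y that by (simp add: m_assoc)
  qed
  have h_one: "h \<one> x" for x
    unfolding h_def using preord_refl[OF lq] by simp
  have segs': "finite (seg lq' b)" if b: "b \<in> carrier G" for b
  proof -
    obtain x where x: "x \<in> carrier G" "h b x" using h_ex[OF b] by blast
    then have "seg lq' b \<subseteq> {a \<in> carrier G. h a x}" unfolding lq'_def by blast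
    then show ?thesis using h_fin[OF x(1)] finite_subset by blast
  qed
  have tot': "lq' a b \<or> lq' b a" for a b
  proof (rule ccontr)
    assume "\<not> (lq' a b \<or> lq' b a)"
    then obtain x x' where "x \<in> carrier G" "x' \<in> carrier G" "h b x" "\<not> h a x" "h a x'" "\<not> h b x'"
      unfolding lq'_def by blast
    then show False using h_mono tot by blast
  qed
  have lq': "preord lq'"
    unfolding preord_def
  proof (intro conjI ballI impI)
    show "lq' x z" if "lq' x y" "lq' y z" for x y z using that unfolding lq'_def by blast
    show "finite {x \<in> carrier G. lq' x b \<and> lq' b x}" if "b \<in> carrier G" for b
      by (rule finite_subset[OF _ segs'[OF that]]) blast
  qed (use D_le' tot' in auto)
  have "low lq' = carrier G" using segs' by (auto simp: low_def)
  then have inf': "infinite (low lq')" using infinite_carrier by simp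
  have "finite ({x \<in> carrier G. lq' x (x [^] p)} \<union> {x \<in> carrier G. lq' x (x [^] q)})"
    using finite_power_not_descending[OF lq' inf' surj_p z]
      finite_power_not_descending[OF lq' inf' surj_q w] by blast
  then obtain x where x0: "x \<in> carrier G"
    "x \<notin> {x \<in> carrier G. lq' x (x [^] p)} \<union> {x \<in> carrier G. lq' x (x [^] q)}"
    by (rule outside_finite)
  then have x: "x \<in> carrier G" "\<not> lq' x (x [^] p)" "\<not> lq' x (x [^] q)" by simp_all
  have refl': "lq' a a" for a unfolding lq'_def by blast
  have lq'_mult: "lq' (a \<otimes> b) m" if "lq' a m" "lq' b m" "a \<in> carrier G" "b \<in> carrier G" for a b m
    using that h_mult unfolding lq'_def by blast
  have lq'_pow: "lq' (a [^] n) m" if "lq' a m" "a \<in> carrier G" for a m and n :: nat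
  proof (induction n)
    case 0
    then show ?case using h_one by (simp add: lq'_def)
  next
    case (Suc n)
    then show ?case using lq'_mult that by simp
  qed
  have key: "lq' x m" if m: "lq' (x [^] p) m" "lq' (x [^] q) m" for m
  proof -
    obtain n :: nat where n: "n > 0" "x [^] n = \<one>" using torsion[OF x(1)] by blast
    have "gcd p q = 1" using \<open>coprime p q\<close> by simp
    \<comment> \<open>By coprimality a vanishing exponent would force the other one to be 1, against
      w or z; so Bezout applies.\<close>
    then obtain u v where uv: "u * p = v * q + 1 \<or> u * q = v * p + 1"
      using bezout_nat[of p q] bezout_nat[of q p] z w
      by (metis gcd.commute gcd_0_nat mult.commute nat_pow_0 nat_pow_eone neq0_conv)
    \<comment> \<open>Only natural powers are controlled by \<open>lq'_pow\<close>. With g being x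
      to the power vt, the inverse of g is therefore written as its (n - 1)-st power, using that x
      has exponent n.\<close>
    have comb: "x = (x [^] s) [^] u \<otimes> ((x [^] t) [^] v) [^] (n - 1)" if "u * s = v * t + 1" for s t u v :: nat
    proof -
      define g where "g = x [^] (v * t)"
      have gc: "g \<in> carrier G" using x(1) by (simp add: g_def)
      have "g \<otimes> g [^] (n - 1) = g [^] n" using gc n(1) by (metis Suc_pred' nat_pow_Suc2)
      also have "\<dots> = \<one>" unfolding g_def using x(1) n(2)
        by (metis mult.commute nat_pow_one nat_pow_pow)
      finally have gg: "g \<otimes> g [^] (n - 1) = \<one>" .
      have "(x [^] s) [^] u = x \<otimes> g" using x(1) that
        by (metis Suc_eq_plus1 g_def mult.commute nat_pow_Suc2 nat_pow_pow)
      moreover have "(x [^] t) [^] v = g" using x(1) by (simp add: g_def nat_pow_pow mult.commute)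
      ultimately show ?thesis using gg gc x(1) by (simp add: m_assoc)
    qed
    have comb': "x = (x [^] s) [^] u \<otimes> (x [^] t) [^] (v * (n - 1))" if "u * s = v * t + 1" for s t u v :: nat
      using comb[OF that] x(1) by (simp add: nat_pow_pow mult.assoc)
    from uv obtain s t i j :: nat where st: "s = p \<or> s = q" "t = p \<or> t = q"
      "x = (x [^] s) [^] i \<otimes> (x [^] t) [^] j"
      using comb' by blast
    have "lq' (x [^] s) m" "lq' (x [^] t) m" using st(1,2) m by auto
    then have "lq' ((x [^] s) [^] i \<otimes> (x [^] t) [^] j) m"
      using x(1) by (rule_tac lq'_mult[OF lq'_pow lq'_pow]) auto
    then show ?thesis using st(3) by simp
  qed
  \<comment> \<open>Taking for m the larger of the two powers puts x at most m, although both powers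
    are strictly below x.\<close>
  from tot'[of "x [^] p" "x [^] q"] show False
    using key[of "x [^] q"] key[of "x [^] p"] refl' x(2,3) by blast
qed

end


section \<open>Minimal groups are commutative\<close>

context min_group
begin

text \<open>An infinite definable subgroup has finite complement, but for an element g outside it
  the complement contains a whole translate of the subgroup.\<close>

lemma definable_subgroup:
  assumes D: "D (\<lambda>e. Q (e 0))"
    and mult: "\<And>x y. x \<in> carrier G \<Longrightarrow> y \<in> carrier G \<Longrightarrow> Q x \<Longrightarrow> Q y \<Longrightarrow> Q (x \<otimes> y)"
    and inv: "\<And>x. x \<in> carrier G \<Longrightarrow> Q x \<Longrightarrow> Q (inv x)"
    and inf: "infinite {x \<in> carrier G. Q x}" and g: "g \<in> carrier G"
  shows "Q g"
proof (rule ccontr)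
  assume n: "\<not> Q g"
  have fin: "finite {x \<in> carrier G. \<not> Q x}" using D_dichotomy[where Q = Q, OF D] inf by blast
  have "g \<otimes> x \<in> {x \<in> carrier G. \<not> Q x}" if x: "x \<in> carrier G" "Q x" for x
  proof -
    have "\<not> Q (g \<otimes> x)"
    proof
      assume "Q (g \<otimes> x)"
      then have "Q (g \<otimes> x \<otimes> inv x)" using x g mult[of "g \<otimes> x" "inv x"] inv[of x] by simp
      then show False using x g n by (simp add: m_assoc)
    qed
    then show ?thesis using x g by simp
  qed
  then have "finite ((\<lambda>x. g \<otimes> x) ` {x \<in> carrier G. Q x})"
    by (intro finite_subset[OF _ fin]) auto
  moreover have "inj_on (\<lambda>x. g \<otimes> x) {x \<in> carrier G. Q x}" using g by (auto simp: inj_on_def)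
  ultimately show False using inf finite_imageD by blast
qed

section \<open>Centralizers and conjugacy classes of noncentral elements\<close>

abbreviation centr :: "'a \<Rightarrow> 'a set" where
  "centr a \<equiv> {x \<in> carrier G. x \<otimes> a = a \<otimes> x}"

definition noncentral :: "'a \<Rightarrow> bool" where
  "noncentral a \<longleftrightarrow> a \<in> carrier G \<and> (\<exists>b\<in>carrier G. b \<otimes> a \<noteq> a \<otimes> b)"

text \<open>Conjugacy is written without inverses, as an equation between products, so that it is
  directly a formula in the named multiplication.\<close>

definition conj_to :: "'a \<Rightarrow> 'a \<Rightarrow> bool" where
  "conj_to a x \<longleftrightarrow> (\<exists>g\<in>carrier G. x \<otimes> g = g \<otimes> a)"

lemma centr_mult:
  assumes "a \<in> carrier G" "x \<in> centr a" "y \<in> centr a" shows "x \<otimes> y \<in> centr a"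
proof -
  have "x \<otimes> y \<otimes> a = x \<otimes> (a \<otimes> y)" using assms by (simp add: m_assoc)
  also have "\<dots> = a \<otimes> x \<otimes> y" using assms by (simp flip: m_assoc)
  finally show ?thesis using assms by (simp add: m_assoc)
qed

lemma centr_inv:
  assumes a: "a \<in> carrier G" and x: "x \<in> centr a" shows "inv x \<in> centr a"
proof -
  have xG: "x \<in> carrier G" and xa: "x \<otimes> a = a \<otimes> x" using x by auto
  have "a = inv x \<otimes> (x \<otimes> a)" using a xG by (simp flip: m_assoc)
  also have "\<dots> = inv x \<otimes> a \<otimes> x" unfolding xa using a xG by (simp add: m_assoc)
  finally have "a \<otimes> inv x = inv x \<otimes> a \<otimes> x \<otimes> inv x" by simp
  also have "\<dots> = inv x \<otimes> a" using assms by (simp add: m_assoc)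
  finally show ?thesis using x by simp
qed

lemma finite_centr:
  assumes "noncentral a" shows "finite (centr a)"
proof (rule ccontr)
  assume inf: "infinite (centr a)"
  have a: "a \<in> carrier G" using assms by (simp add: noncentral_def)
  have "g \<otimes> a = a \<otimes> g" if "g \<in> carrier G" for g
  proof (rule definable_subgroup[where Q = "\<lambda>x. x \<otimes> a = a \<otimes> x"])
    show "D (\<lambda>e. e 0 \<otimes> a = a \<otimes> e 0)"
      by (intro dfn_eq T_mult dtm_var T_par a)
  qed (use centr_mult[OF a] centr_inv[OF a] inf that in auto)
  then show False using assms unfolding noncentral_def by blast
qed

text \<open>The fibres of the map sending g to the conjugate of a by g are translates of the
  centralizer of a, hence finite, while the group is infinite.\<close>

lemma infinite_conj_class:
  assumes nc: "noncentral a" shows "infinite {x \<in> carrier G. conj_to a x}"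
proof
  assume fin: "finite {x \<in> carrier G. conj_to a x}"
  have a: "a \<in> carrier G" using assms by (simp add: noncentral_def)
  let ?c = "\<lambda>g. g \<otimes> a \<otimes> inv g"
  have "?c ` carrier G \<subseteq> {x \<in> carrier G. conj_to a x}"
  proof
    fix x assume "x \<in> ?c ` carrier G"
    then obtain g where g: "g \<in> carrier G" "x = ?c g" by blast
    then have "x \<otimes> g = g \<otimes> a" using a by (simp add: m_assoc)
    then show "x \<in> {x \<in> carrier G. conj_to a x}" using g a unfolding conj_to_def by auto
  qed
  then have "finite (?c ` carrier G)" using fin finite_subset by blast
  then obtain g0 where g0: "g0 \<in> carrier G" "infinite {g \<in> carrier G. ?c g = ?c g0}"
    using pigeonhole_infinite[OF infinite_carrier, of ?c] by blast
  have "inv g0 \<otimes> g \<in> centr a" if g: "g \<in> carrier G" "?c g = ?c g0" for g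
  proof -
    have "inv g0 \<otimes> g \<otimes> a = inv g0 \<otimes> (?c g \<otimes> g)" using g(1) a g0(1) by (simp add: m_assoc)
    also have "\<dots> = inv g0 \<otimes> (?c g0 \<otimes> g)" unfolding g(2) ..
    also have "\<dots> = a \<otimes> (inv g0 \<otimes> g)" using g(1) a g0(1) by (simp add: m_assoc inv_solve_left')
    finally show ?thesis using g(1) g0(1) by simp
  qed
  then have "(\<lambda>g. inv g0 \<otimes> g) ` {g \<in> carrier G. ?c g = ?c g0} \<subseteq> centr a" by blast
  then have "finite ((\<lambda>g. inv g0 \<otimes> g) ` {g \<in> carrier G. ?c g = ?c g0})"
    using finite_centr[OF nc] finite_subset by blast
  moreover have "inj_on (\<lambda>g. inv g0 \<otimes> g) {g \<in> carrier G. ?c g = ?c g0}"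
    using g0(1) by (auto simp: inj_on_def)
  ultimately show False using g0(2) finite_imageD by blast
qed

text \<open>Both conjugacy classes are infinite and definable, hence cofinite, so they meet.\<close>

lemma noncentral_conj:
  assumes a: "noncentral a" and b: "noncentral b"
  shows "conj_to a b"
proof -
  have aG: "a \<in> carrier G" and bG: "b \<in> carrier G" using a b by (auto simp: noncentral_def)
  have cofin: "finite {x \<in> carrier G. \<not> conj_to c x}" if c: "noncentral c" for c
  proof -
    have cG: "c \<in> carrier G" using c by (simp add: noncentral_def)
    have "D (\<lambda>e. e 0 \<otimes> e 1 = e 1 \<otimes> c)"
      by (intro dfn_eq T_mult dtm_var T_par cG)
    from D_ex[OF this, of 1] have "D (\<lambda>e. conj_to c (e 0))" unfolding conj_to_def by simp
    from D_dichotomy[where Q = "conj_to c", OF this] show ?thesis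
      using infinite_conj_class[OF c] by blast
  qed
  have "finite ({x \<in> carrier G. \<not> conj_to a x} \<union> {x \<in> carrier G. \<not> conj_to b x})"
    using cofin a b by blast
  then obtain x where x: "x \<in> carrier G"
    "x \<notin> {x \<in> carrier G. \<not> conj_to a x} \<union> {x \<in> carrier G. \<not> conj_to b x}"
    by (rule outside_finite)
  then have "conj_to a x" "conj_to b x" by auto
  then obtain g h where gh: "g \<in> carrier G" "x \<otimes> g = g \<otimes> a" "h \<in> carrier G" "x \<otimes> h = h \<otimes> b"
    unfolding conj_to_def by blast
  have "b \<otimes> (inv h \<otimes> g) = inv h \<otimes> (h \<otimes> b) \<otimes> inv h \<otimes> g"
    using gh bG by (simp flip: m_assoc)
  also have "\<dots> = inv h \<otimes> (x \<otimes> g)" unfolding gh(4)[symmetric] using gh(1,3) x(1) by (simp add: m_assoc)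
  also have "\<dots> = inv h \<otimes> g \<otimes> a" unfolding gh(2) using gh(1,3) aG by (simp add: m_assoc)
  finally show ?thesis unfolding conj_to_def using gh by blast
qed

text \<open>If the square of a were central, all noncentral elements, being conjugate to a, would
  have that same square. For g not commuting with a, both g and ga are noncentral; comparing their
  squares gives gag = a, which makes the conjugate of a by g the inverse of a. The class of a would
  then have at most two elements.\<close>

lemma noncentral_square:
  assumes a: "noncentral a" shows "noncentral (a \<otimes> a)"
proof (rule ccontr)
  assume na: "\<not> noncentral (a \<otimes> a)"
  have aG: "a \<in> carrier G" using a by (simp add: noncentral_def)
  have sc: "b \<otimes> (a \<otimes> a) = (a \<otimes> a) \<otimes> b" if "b \<in> carrier G" for b
    using na aG that unfolding noncentral_def by blast
  have sq: "b \<otimes> b = a \<otimes> a" if b: "noncentral b" for b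
  proof -
    have bG: "b \<in> carrier G" using b by (simp add: noncentral_def)
    obtain g where g: "g \<in> carrier G" "b \<otimes> g = g \<otimes> a"
      using noncentral_conj[OF a b] unfolding conj_to_def by blast
    have "b \<otimes> b \<otimes> g = b \<otimes> (g \<otimes> a)" using bG g by (simp add: m_assoc)
    also have "\<dots> = g \<otimes> (a \<otimes> a)" using bG g aG by (simp flip: m_assoc)
    also have "\<dots> = a \<otimes> a \<otimes> g" using sc g(1) by simp
    finally show ?thesis using g(1) aG bG by simp
  qed
  \<comment> \<open>The second alternative is the inverse of a, in the form in which the computation
    delivers it.\<close>
  have "x = a \<or> x = a \<otimes> inv (a \<otimes> a)" if x: "x \<in> carrier G" "conj_to a x" for x
  proof -
    obtain g where g: "g \<in> carrier G" "x \<otimes> g = g \<otimes> a" using x(2) unfolding conj_to_def by blast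
    show ?thesis
    proof (cases "g \<otimes> a = a \<otimes> g")
      case True
      then show ?thesis using g x(1) aG by (metis right_cancel)
    next
      case False
      then have ncg: "noncentral g" using g(1) aG unfolding noncentral_def by metis
      have "g \<otimes> a \<otimes> a \<noteq> a \<otimes> (g \<otimes> a)"
      proof
        assume "g \<otimes> a \<otimes> a = a \<otimes> (g \<otimes> a)"
        then have "g \<otimes> a \<otimes> a = a \<otimes> g \<otimes> a" using g(1) aG by (simp add: m_assoc)
        then show False using False g(1) aG by (metis m_closed right_cancel)
      qed
      then have ncga: "noncentral (g \<otimes> a)" using g(1) aG unfolding noncentral_def by (metis m_closed)
      have "(g \<otimes> a \<otimes> g) \<otimes> a = a \<otimes> a" using sq[OF ncga] g(1) aG by (simp add: m_assoc)
      then have gag: "g \<otimes> a \<otimes> g = a" using g(1) aG by (metis m_closed right_cancel)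
      have "x \<otimes> (a \<otimes> a) = x \<otimes> (g \<otimes> g)" using sq[OF ncg] by simp
      also have "\<dots> = a" using gag g x(1) aG by (simp flip: m_assoc)
      finally have "x = a \<otimes> inv (a \<otimes> a)" using x(1) aG by (metis inv_solve_right m_closed)
      then show ?thesis ..
    qed
  qed
  then have "{x \<in> carrier G. conj_to a x} \<subseteq> {a, a \<otimes> inv (a \<otimes> a)}" by blast
  then have "finite {x \<in> carrier G. conj_to a x}" by (rule finite_subset) simp
  then show False using infinite_conj_class[OF a] by simp
qed

text \<open>If y conjugates a to its inverse, then \<open>y \<otimes> y\<close> commutes with a, but y does not. This is
  impossible, as y and \<open>y \<otimes> y\<close> are conjugate and so have equally large finite centralizers.\<close>

lemma is_comm_group: "comm_group G"
proof (rule group_comm_groupI, rule ccontr)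
  fix b a assume "b \<in> carrier G" "a \<in> carrier G" "b \<otimes> a \<noteq> a \<otimes> b"
  then have a: "noncentral a" and aG: "a \<in> carrier G" unfolding noncentral_def by blast+
  have "noncentral (inv a)"
  proof -
    have "b \<otimes> inv a \<noteq> inv a \<otimes> b"
    proof
      assume "b \<otimes> inv a = inv a \<otimes> b"
      then have "inv a \<in> centr b" using \<open>b \<in> carrier G\<close> aG by simp
      from centr_inv[OF \<open>b \<in> carrier G\<close> this] show False using \<open>b \<otimes> a \<noteq> a \<otimes> b\<close> aG by simp
    qed
    then show ?thesis using aG \<open>b \<in> carrier G\<close> unfolding noncentral_def by blast
  qed
  then obtain y where y: "y \<in> carrier G" "inv a \<otimes> y = y \<otimes> a"
    using noncentral_conj[OF a] unfolding conj_to_def by blast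
  have ay: "a \<otimes> y = y \<otimes> inv a"
  proof -
    have "a \<otimes> y = a \<otimes> (y \<otimes> a) \<otimes> inv a" using aG y(1) by (simp add: m_assoc)
    also have "\<dots> = y \<otimes> inv a" unfolding y(2)[symmetric] using aG y(1) by (simp flip: m_assoc)
    finally show ?thesis .
  qed
  have "y \<otimes> y \<otimes> a = y \<otimes> (inv a \<otimes> y)" using aG y by (simp add: m_assoc)
  also have "\<dots> = a \<otimes> (y \<otimes> y)" using aG y(1) ay by (simp flip: m_assoc)
  finally have ayy: "a \<in> centr (y \<otimes> y)" using aG by simp
  \<comment> \<open>If y commuted with a, then a would equal its inverse and its square would be the
    identity, hence central.\<close>
  have a_y: "y \<otimes> a \<noteq> a \<otimes> y"
  proof
    assume "y \<otimes> a = a \<otimes> y"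
    then have "inv a \<otimes> y = a \<otimes> y" using y(2) by simp
    then have "inv a = a" using aG y(1) by simp
    then have "a \<otimes> a = \<one>" using aG by (metis r_inv)
    then have "\<not> noncentral (a \<otimes> a)" unfolding noncentral_def by simp
    then show False using noncentral_square[OF a] by simp
  qed
  then have ncy: "noncentral y" using y(1) aG unfolding noncentral_def by metis
  have ncyy: "noncentral (y \<otimes> y)" by (rule noncentral_square[OF ncy])
  obtain g where g: "g \<in> carrier G" "(y \<otimes> y) \<otimes> g = g \<otimes> y"
    using noncentral_conj[OF ncy ncyy] unfolding conj_to_def by blast
  have gyy: "inv g \<otimes> (y \<otimes> y) = y \<otimes> inv g"
  proof -
    have "inv g \<otimes> (y \<otimes> y) = inv g \<otimes> ((y \<otimes> y) \<otimes> g) \<otimes> inv g" using g(1) y(1) by (simp add: m_assoc)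
    also have "\<dots> = y \<otimes> inv g" unfolding g(2) using g(1) y(1) by (simp flip: m_assoc)
    finally show ?thesis .
  qed
  \<comment> \<open>Conjugation by g embeds the centralizer of the square of y into that of y. The
    reverse inclusion always holds, so the two finite sets are equal, and a lies in only one of
    them.\<close>
  let ?f = "\<lambda>x. inv g \<otimes> x \<otimes> g"
  have "?f x \<in> centr y" if x: "x \<in> centr (y \<otimes> y)" for x
  proof -
    have xG: "x \<in> carrier G" using x by simp
    have "?f x \<otimes> y = inv g \<otimes> x \<otimes> (g \<otimes> y)" using xG g(1) y(1) by (simp add: m_assoc)
    also have "\<dots> = inv g \<otimes> (x \<otimes> (y \<otimes> y)) \<otimes> g"
      unfolding g(2)[symmetric] using xG g(1) y(1) by (simp add: m_assoc)
    also have "\<dots> = inv g \<otimes> (y \<otimes> y) \<otimes> x \<otimes> g"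
      using x xG g(1) y(1) by (simp add: m_assoc)
    also have "\<dots> = y \<otimes> ?f x" unfolding gyy using xG g(1) y(1) by (simp add: m_assoc)
    finally show ?thesis using xG g(1) by simp
  qed
  moreover have "inj_on ?f (centr (y \<otimes> y))"
    using g(1) by (auto simp: inj_on_def m_assoc)
  ultimately have "card (centr (y \<otimes> y)) \<le> card (centr y)"
    using finite_centr[OF ncy] by (intro card_inj_on_le[of ?f]) auto
  moreover have "centr y \<subseteq> centr (y \<otimes> y)"
  proof
    fix x assume x: "x \<in> centr y"
    then have "x \<otimes> (y \<otimes> y) = y \<otimes> x \<otimes> y" using y(1) by (simp flip: m_assoc)
    also have "\<dots> = y \<otimes> y \<otimes> x" using x y(1) by (simp add: m_assoc)
    finally show "x \<in> centr (y \<otimes> y)" using x by simp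
  qed
  ultimately have "centr y = centr (y \<otimes> y)"
    using finite_centr[OF ncyy] by (intro card_seteq) auto
  then have "a \<in> centr y" using ayy by (simp only:)
  then show False using a_y by simp
qed

end


section \<open>Almost linear minimal groups\<close>

lemma only_prime_divisor_power:
  assumes "n > 0" "\<And>q. prime q \<Longrightarrow> q dvd n \<Longrightarrow> q = p"
  shows "\<exists>k. n = (p::nat) ^ k"
  using assms
proof (induction n rule: less_induct)
  case (less n)
  show ?case
  proof (cases "n = 1")
    case True
    then show ?thesis by (intro exI[of _ 0]) simp
  next
    case False
    then obtain q where q: "prime q" "q dvd n" using prime_factor_nat by blast
    then have "q = p" using less.prems(2) by blast
    obtain m where m: "n = p * m" using q \<open>q = p\<close> by blast
    have "m > 0" "m < n" using less.prems(1) m q(1) \<open>q = p\<close> prime_gt_1_nat by auto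
    moreover have "q' = p" if "prime q'" "q' dvd m" for q'
      using less.prems(2)[OF that(1)] that(2) m by simp
    ultimately obtain k where "m = p ^ k" using less.IH by blast
    then have "n = p ^ Suc k" using m by simp
    then show ?thesis by blast
  qed
qed

context min_comm_group
begin

text \<open>Kernel and image of a power map are definable subgroups. An infinite kernel is
  everything; a finite kernel makes all fibres finite, so the image is infinite and therefore
  everything.\<close>

lemma finite_kernel_or_exponent:
  obtains "\<And>x. x \<in> carrier G \<Longrightarrow> x [^] (n::nat) = \<one>"
  | "finite {x \<in> carrier G. x [^] n = \<one>}" "\<And>x. x \<in> carrier G \<Longrightarrow> \<exists>y\<in>carrier G. y [^] n = x"
proof (cases "finite {x \<in> carrier G. x [^] n = \<one>}")
  case False
  have "x [^] n = \<one>" if "x \<in> carrier G" for x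
    by (rule definable_subgroup[where Q = "\<lambda>x. x [^] n = \<one>"])
      (use False that in \<open>auto simp: nat_pow_distrib nat_pow_inv intro!: dfn_eq T_pow dtm_var T_par\<close>)
  then show ?thesis by (rule that(1))
next
  case True
  have inf: "infinite {x \<in> carrier G. \<exists>y\<in>carrier G. y [^] n = x}"
  proof
    assume "finite {x \<in> carrier G. \<exists>y\<in>carrier G. y [^] n = x}"
    then have "finite ((\<lambda>y. y [^] n) ` carrier G)" by (rule finite_subset[rotated]) auto
    then obtain y where y: "y \<in> carrier G" "infinite {x \<in> carrier G. x [^] n = y [^] n}"
      using pigeonhole_infinite[OF infinite_carrier, of "\<lambda>y. y [^] n"] by blast
    have "finite {x \<in> carrier G. x \<otimes> inv y \<in> {x \<in> carrier G. x [^] n = \<one>}}"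
      by (rule finite_preimage_mult[OF True]) (use y(1) in simp)
    moreover have "{x \<in> carrier G. x [^] n = y [^] n} \<subseteq>
        {x \<in> carrier G. x \<otimes> inv y \<in> {x \<in> carrier G. x [^] n = \<one>}}"
      using y(1) by (auto simp: nat_pow_distrib nat_pow_inv)
    ultimately show False using y(2) finite_subset by blast
  qed
  have "D (\<lambda>e. e 1 [^] n = e 0)" by (intro dfn_eq T_pow dtm_var)
  from D_ex[OF this, of 1] have D: "D (\<lambda>e. \<exists>y\<in>carrier G. y [^] n = e 0)" by simp
  have "\<exists>y\<in>carrier G. y [^] n = x" if x: "x \<in> carrier G" for x
  proof (rule definable_subgroup[where Q = "\<lambda>x. \<exists>y\<in>carrier G. y [^] n = x", OF D _ _ inf x])
    show "\<exists>y\<in>carrier G. y [^] n = x1 \<otimes> x2"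
      if "\<exists>y\<in>carrier G. y [^] n = x1" "\<exists>y\<in>carrier G. y [^] n = x2" for x1 x2
      using that nat_pow_distrib m_closed by metis
    show "\<exists>y\<in>carrier G. y [^] n = inv x1" if "\<exists>y\<in>carrier G. y [^] n = x1" for x1
      using that nat_pow_inv inv_closed by metis
  qed
  with True show ?thesis by (rule that(2))
qed

text \<open>Without prime exponent all prime power maps are onto, in particular squaring, as the
  translation argument demands. The order is adjusted twice: by passing to the converse if
  necessary, so that infinitely many segments are finite, and by lowering finitely many elements, so
  that all are.\<close>

lemma exponent_or_single_prime:
  assumes lq0: "preord lq0"
  obtains p where "prime (p::nat)" "\<And>x. x \<in> carrier G \<Longrightarrow> x [^] p = \<one>"
  | p where "prime (p::nat)" "\<And>x. x \<in> carrier G \<Longrightarrow> \<exists>k. x [^] (p ^ k) = \<one>"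
      "\<And>x. x \<in> carrier G \<Longrightarrow> \<exists>y\<in>carrier G. y [^] p = x" "finite {x \<in> carrier G. x [^] p = \<one>}"
proof (cases "\<exists>p::nat. prime p \<and> (\<forall>x\<in>carrier G. x [^] p = \<one>)")
  case True
  then show ?thesis using that(1) by blast
next
  case False
  have fin: "finite {x \<in> carrier G. x [^] p = \<one>}"
    and surj: "\<And>x. x \<in> carrier G \<Longrightarrow> \<exists>y\<in>carrier G. y [^] p = x" if "prime p" for p :: nat
    using finite_kernel_or_exponent[of p] False that by blast+
  \<comment> \<open>A cofinite initial segment of b leaves a finite final one, since the class of b
    is finite; so every b is low for the order or for its converse.\<close>
  have "carrier G \<subseteq> low lq0 \<union> low (\<lambda>x y. lq0 y x)"
  proof
    fix b assume b: "b \<in> carrier G"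
    have "finite {x \<in> carrier G. lq0 x b} \<or> finite {x \<in> carrier G. \<not> lq0 x b}"
      by (rule D_dichotomy[where Q = "\<lambda>x. lq0 x b"]) (intro D_preord[OF lq0] T_par dtm_var b)
    moreover have "{x \<in> carrier G. lq0 b x} \<subseteq>
        {x \<in> carrier G. \<not> lq0 x b} \<union> {x \<in> carrier G. lq0 x b \<and> lq0 b x}" by blast
    ultimately show "b \<in> low lq0 \<union> low (\<lambda>x y. lq0 y x)"
      using b preordD(4)[OF lq0 b] unfolding low_def
      by (metis (no_types, lifting) UnI1 UnI2 finite_UnI finite_subset mem_Collect_eq)
  qed
  then have "infinite (low lq0) \<or> infinite (low (\<lambda>x y. lq0 y x))"
    using infinite_carrier finite_subset by blast
  then obtain lq where lq: "preord lq" and inf: "infinite (low lq)"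
    using lq0 preord_converse[OF lq0] by blast
  have sq: "\<exists>y\<in>carrier G. y [^] (2::nat) = x" if "x \<in> carrier G" for x
    using surj[OF two_is_prime_nat that] .
  have torsion: "\<exists>n::nat. n > 0 \<and> a [^] n = \<one>" if "a \<in> carrier G" for a
    by (rule torsion_of_preord[OF lq inf]) (use sq that in auto)
  have ord_pos: "ord x > 0" if "x \<in> carrier G" for x
    using torsion[OF that] that by (metis gr0I ord_eq_0)
  obtain x where x: "x \<in> carrier G" "x \<notin> {\<one>}" using outside_finite[of "{\<one>}"] by auto
  then have "ord x \<noteq> 1" using ord_eq_1 by auto
  then obtain p where p: "prime p" "p dvd ord x" using prime_factor_nat by blast
  \<comment> \<open>The cyclic group generated by x contains an element of order q for each prime
    divisor q of the order of x; these are the kernel elements required by the counting.\<close>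
  have prime_elt: "x [^] (ord x div q) \<noteq> \<one> \<and> (x [^] (ord x div q)) [^] q = \<one>"
    if "x \<in> carrier G" "prime q" "q dvd ord x" for x q
  proof
    have "ord x div q < ord x" "ord x div q > 0"
      using ord_pos[OF that(1)] that(3) prime_gt_1_nat[OF that(2)] by (auto elim!: dvdE)
    then show "x [^] (ord x div q) \<noteq> \<one>"
      using pow_eq_id[OF that(1)] by (meson dvd_imp_le leD)
    show "(x [^] (ord x div q)) [^] q = \<one>"
      using that by (simp add: nat_pow_pow)
  qed
  define z where "z = x [^] (ord x div p)"
  have z: "z \<in> carrier G" "z \<noteq> \<one>" "z [^] p = \<one>"
    using prime_elt[OF x(1) p] x(1) by (auto simp: z_def)
  define F where "F = carrier G - low lq"
  have F: "finite F" "F \<subseteq> carrier G"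
    using low_cofinite[OF lq inf _ z] surj[OF p(1)] by (auto simp: F_def)
  define lq' where "lq' x y \<longleftrightarrow> x \<in> F \<or> y \<notin> F \<and> lq x y" for x y
  have "preord (\<lambda>x y. x \<in> F \<or> y \<notin> F \<and> lq x y)"
  proof (rule preord_bottom[OF F preordD(1)[OF lq]])
    show "finite {x \<in> carrier G - F. lq x b \<and> lq b x}" if "b \<in> carrier G - F" for b
      by (rule finite_subset[OF _ preordD(4)[OF lq, of b]]) (use that in auto)
  qed (use preordD(2,3)[OF lq] in blast)+
  then have lq': "preord lq'" by (simp add: lq'_def[abs_def])
  have segs: "finite (seg lq' b)" if b: "b \<in> carrier G" for b
  proof (cases "b \<in> F")
    case True
    then have "seg lq' b \<subseteq> F" by (auto simp: lq'_def)
    then show ?thesis using F(1) finite_subset by blast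
  next
    case False
    then have "b \<in> low lq" using b by (simp add: F_def)
    then have "finite (seg lq b \<union> F)" using F(1) by (simp add: low_def)
    moreover have "seg lq' b \<subseteq> seg lq b \<union> F" by (auto simp: lq'_def)
    ultimately show ?thesis using finite_subset by blast
  qed
  have "low lq' = carrier G" using segs by (auto simp: low_def)
  then have inf': "infinite (low lq')" using infinite_carrier by simp
  have moved: "finite {x \<in> carrier G. \<not> (lq' (x \<otimes> a) x \<and> lq' x (x \<otimes> a))}"
    if "a \<in> carrier G" for a
    by (rule finite_moved_by_translation[OF lq' inf']) (use sq that in auto)
  have "\<exists>k. x [^] (p ^ k) = \<one>" if x: "x \<in> carrier G" for x
  proof -
    have "q = p" if q: "prime q" "q dvd ord x" for q
    proof (rule ccontr)
      assume "q \<noteq> p"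
      then have "coprime p q" using p(1) q(1) by (simp add: primes_coprime)
      moreover have "x [^] (ord x div q) \<in> carrier G" using x by simp
      ultimately show False
        using prime_elt[OF x q] surj[OF p(1)] surj[OF q(1)] segs moved torsion
        by (intro at_most_one_prime[OF lq' _ _ _ _ _ _ z]) auto
    qed
    then obtain k where "ord x = p ^ k" using only_prime_divisor_power[OF ord_pos[OF x]] by blast
    then show ?thesis using pow_ord_eq_1[OF x] by metis
  qed
  then show ?thesis by (rule that(2)[OF p(1) _ surj[OF p(1)] fin[OF p(1)]])
qed

text \<open>Here x is at most y if y is not strictly below x. If z < x refuted transitivity, a
  strict relation from x to y or from y to z would contradict an assumption, so both pairs would be
  incomparable, and with them x and z. An infinite class would be cofinite and contain two members
  of the infinite chain, yet any two of its members outside F are incomparable.\<close>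

lemma preord_of_almost_linear:
  assumes D: "D (\<lambda>e. R (e 0) (e 1))" and po: "strict_partial_order_on (carrier G) R"
    and chain: "has_infinite_chain (carrier G) R" and F: "finite F" "F \<subseteq> carrier G"
    and trans: "\<And>x y z. x \<in> carrier G - F \<Longrightarrow> y \<in> carrier G - F \<Longrightarrow> z \<in> carrier G - F \<Longrightarrow>
       incomparability R x y \<Longrightarrow> incomparability R y z \<Longrightarrow> incomparability R x z"
  shows "preord (\<lambda>x y. x \<in> F \<or> y \<notin> F \<and> \<not> R y x)"
proof (rule preord_bottom[OF F])
  have asym: "\<not> (R x y \<and> R y x)" if "x \<in> carrier G" "y \<in> carrier G" for x y
    using po that unfolding strict_partial_order_on_def by blast
  have tr: "R x z" if "x \<in> carrier G" "y \<in> carrier G" "z \<in> carrier G" "R x y" "R y z" for x y z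
    using po that unfolding strict_partial_order_on_def by blast
  have DR: "D (\<lambda>e. R (t e) (s e))" if "T t" "T s" for t s
    by (rule D_subst[where R = R, OF D that])
  show "D (\<lambda>e. \<not> R (e 1) (e 0))" by (intro dfn_neg DR dtm_var)
  show "\<not> R y x \<or> \<not> R x y" if "x \<in> carrier G - F" "y \<in> carrier G - F" for x y
    using asym that by blast
  show "\<not> R z x" if xyz: "x \<in> carrier G - F" "y \<in> carrier G - F" "z \<in> carrier G - F"
    and "\<not> R y x" "\<not> R z y" for x y z
  proof
    assume zx: "R z x"
    show False
    proof (cases "R x y \<or> R y z")
      case True
      then show False using tr[of z x y] tr[of y z x] xyz zx \<open>\<not> R y x\<close> \<open>\<not> R z y\<close> by blast
    next
      case False
      then have "incomparability R x y" "incomparability R y z"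
        using \<open>\<not> R y x\<close> \<open>\<not> R z y\<close> by (auto simp: incomparability_def)
      then have "incomparability R x z" using trans xyz by blast
      then show False using zx by (simp add: incomparability_def)
    qed
  qed
  show "finite {x \<in> carrier G - F. \<not> R b x \<and> \<not> R x b}" if b: "b \<in> carrier G - F" for b
  proof (rule ccontr)
    assume inf: "infinite {x \<in> carrier G - F. \<not> R b x \<and> \<not> R x b}"
    have "D (\<lambda>e. \<not> R b (e 0) \<and> \<not> R (e 0) b)"
      using b by (intro dfn_conj dfn_neg DR dtm_var T_par) auto
    from D_dichotomy[where Q = "\<lambda>x. \<not> R b x \<and> \<not> R x b", OF this]
    have "finite {x \<in> carrier G. \<not> R b x \<and> \<not> R x b} \<or>
      finite {x \<in> carrier G. \<not> (\<not> R b x \<and> \<not> R x b)}" .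
    moreover have "infinite {x \<in> carrier G. \<not> R b x \<and> \<not> R x b}"
      by (rule infinite_super[OF _ inf]) blast
    ultimately have fin: "finite {x \<in> carrier G. \<not> (\<not> R b x \<and> \<not> R x b)}" (is "finite ?K") by blast
    obtain C where C: "C \<subseteq> carrier G" "infinite C" "\<forall>x\<in>C. \<forall>y\<in>C. x \<noteq> y \<longrightarrow> R x y \<or> R y x"
      using chain unfolding has_infinite_chain_def by blast
    have "infinite (C - (F \<union> ?K))" using C(2) F(1) fin by (simp add: Diff_infinite_finite)
    then obtain x where x: "x \<in> C - (F \<union> ?K)" using infinite_imp_nonempty by blast
    have "infinite (C - (F \<union> ?K) - {x})"
      using \<open>infinite (C - (F \<union> ?K))\<close> by (rule Diff_infinite_finite[rotated]) simp
    then obtain y where y: "y \<in> C - (F \<union> ?K) - {x}" using infinite_imp_nonempty by blast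
    have "incomparability R x b" "incomparability R b y"
      using x y C(1) unfolding incomparability_def by blast+
    then have "incomparability R x y" using trans[of x b y] x y b C(1) by blast
    then show False using C(3) x y unfolding incomparability_def by blast
  qed
qed

end


section \<open>Pruefer groups\<close>

text \<open>For positive p these are primitive roots of unity of order \<open>p ^ k\<close>, chosen
  compatibly: each is the p-th power of the next.\<close>

definition prufer_gen :: "nat \<Rightarrow> nat \<Rightarrow> complex" where
  "prufer_gen p k = cis (2 * pi / p ^ k)"

lemma prufer_gen_power:
  assumes "p > 0" shows "prufer_gen p (k + l) ^ (p ^ l) = prufer_gen p k"
  using assms by (simp add: prufer_gen_def DeMoivre power_add)

lemma prufer_gen_0 [simp]: "prufer_gen p 0 = 1"
  by (simp add: prufer_gen_def)

lemma prufer_gen_order: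
  assumes "p > 0" shows "prufer_gen p k ^ (p ^ k) = 1"
  using prufer_gen_power[OF assms, of 0 k] by simp

text \<open>The powers with exponent below \<open>p ^ k\<close> are the distinct roots of unity of
  that order. This is what makes maps defined on powers of the generators well defined.\<close>

lemma prufer_gen_power_eq:
  assumes p: "p > 0" and eq: "prufer_gen p k ^ i = prufer_gen p k ^ j"
  shows "[i = j] (mod p ^ k)"
proof -
  let ?w = "prufer_gen p k"
  have mod: "?w ^ i = ?w ^ (i mod p ^ k)" for i
  proof -
    have "?w ^ i = ?w ^ (p ^ k * (i div p ^ k) + i mod p ^ k)" by simp
    also have "\<dots> = ?w ^ (i mod p ^ k)"
      unfolding power_add power_mult using prufer_gen_order[OF p] by simp
    finally show ?thesis .
  qed
  have "0 < p ^ k" using p by simp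
  from bij_betw_roots_unity[OF this]
  have "inj_on (\<lambda>i. cis (2 * pi * real i / real (p ^ k))) {..<p ^ k}" by (rule bij_betw_imp_inj_on)
  moreover have "(\<lambda>i. cis (2 * pi * real i / real (p ^ k))) = (\<lambda>i. ?w ^ i)"
    by (simp add: prufer_gen_def DeMoivre mult_ac)
  ultimately have "inj_on (\<lambda>i. ?w ^ i) {..<p ^ k}" by simp
  moreover have "?w ^ (i mod p ^ k) = ?w ^ (j mod p ^ k)" using eq mod by metis
  ultimately show ?thesis using p unfolding cong_def inj_on_def by simp
qed

lemma prufer_carrier:
  assumes "p > 0"
  shows "z \<in> carrier (prufer_group p) \<longleftrightarrow> (\<exists>k i. z = prufer_gen p k ^ i)"
proof
  assume "z \<in> carrier (prufer_group p)"
  then obtain k where k: "z ^ (p ^ k) = 1" by (auto simp: prufer_group_def)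
  have "0 < p ^ k" using assms by simp
  from bij_betw_roots_unity[OF this] k
  obtain i where "z = cis (2 * pi * real i / real (p ^ k))"
    unfolding bij_betw_def by (metis (mono_tags, lifting) imageE mem_Collect_eq)
  then have "z = prufer_gen p k ^ i" by (simp add: prufer_gen_def DeMoivre mult_ac)
  then show "\<exists>k i. z = prufer_gen p k ^ i" by blast
next
  assume "\<exists>k i. z = prufer_gen p k ^ i"
  then obtain k i where "z = prufer_gen p k ^ i" by blast
  then have "z ^ (p ^ k) = 1"
    by (metis assms mult.commute power_mult power_one prufer_gen_order)
  then show "z \<in> carrier (prufer_group p)" by (auto simp: prufer_group_def)
qed

lemma prufer_simps [simp]:
  "z \<otimes>\<^bsub>prufer_group p\<^esub> z' = z * z'" "\<one>\<^bsub>prufer_group p\<^esub> = 1"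
  by (simp_all add: prufer_group_def)

text \<open>Both factors are powers of the generator at level k + l, which serves as a common
  denominator without comparing k and l.\<close>

lemma prufer_gen_mult:
  assumes "p > 0"
  shows "prufer_gen p k ^ i * prufer_gen p l ^ j = prufer_gen p (k + l) ^ (p ^ l * i + p ^ k * j)"
  using prufer_gen_power[OF assms, of k l] prufer_gen_power[OF assms, of l k]
  by (simp add: power_add power_mult add.commute)

lemma group_prufer:
  assumes "p > 0" shows "group (prufer_group p)"
proof (rule groupI)
  fix x y assume xy: "x \<in> carrier (prufer_group p)" "y \<in> carrier (prufer_group p)"
  show "x \<otimes>\<^bsub>prufer_group p\<^esub> y \<in> carrier (prufer_group p)"
    using xy unfolding prufer_carrier[OF assms] prufer_simps by (metis prufer_gen_mult[OF assms])
next
  fix x assume "x \<in> carrier (prufer_group p)"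
  then obtain n where n: "x ^ (p ^ n) = 1" by (auto simp: prufer_group_def)
  have "p ^ n > 0" using assms by simp
  then have "x \<noteq> 0" using n by (metis power_0_left not_gr_zero zero_neq_one)
  then have "inverse x * x = 1" "inverse x ^ (p ^ n) = 1" using n by (simp_all add: power_inverse)
  then show "\<exists>y\<in>carrier (prufer_group p). y \<otimes>\<^bsub>prufer_group p\<^esub> x = \<one>\<^bsub>prufer_group p\<^esub>"
    by (intro bexI[of _ "inverse x"]) (auto simp: prufer_group_def)
qed (auto simp: prufer_group_def intro: exI[of _ 0])

lemma prufer_divisible:
  assumes "p > 0" "z \<in> carrier (prufer_group p)"
  obtains y where "y \<in> carrier (prufer_group p)" "y ^ p = z"
proof -
  obtain k i where z: "z = prufer_gen p k ^ i" using assms prufer_carrier by blast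
  let ?y = "prufer_gen p (k + 1) ^ i"
  have "?y ^ p = (prufer_gen p (k + 1) ^ p ^ 1) ^ i" by (simp add: mult.commute flip: power_mult)
  also have "\<dots> = z" unfolding prufer_gen_power[OF assms(1)] z ..
  finally show ?thesis using that[of ?y] prufer_carrier[OF assms(1)] by blast
qed

abbreviation prufer_sum :: "nat \<Rightarrow> nat \<Rightarrow> (nat \<Rightarrow> complex) monoid" where
  "prufer_sum p n \<equiv> sum_group {..<n} (\<lambda>_. prufer_group p)"

lemma carrier_prufer_sum:
  assumes "p > 0"
  shows "carrier (prufer_sum p n) = (\<Pi>\<^sub>E i\<in>{..<n}. carrier (prufer_group p))"
  using group_prufer[OF assms] by (subst carrier_sum_group) auto


section \<open>Divisible p-groups with finite socle\<close>

context comm_group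
begin

section \<open>Homomorphisms from a Pruefer group given by sequences of roots\<close>

lemma root_sequence_power:
  assumes "\<And>k. c k \<in> carrier G" "\<And>k. c (Suc k) [^] (p::nat) = c k"
  shows "c (k + l) [^] (p ^ l) = c k"
proof (induction l)
  case (Suc l)
  have "c (k + Suc l) [^] (p ^ Suc l) = (c (Suc (k + l)) [^] p) [^] (p ^ l)"
    using assms(1) by (simp add: nat_pow_pow)
  then show ?case using Suc assms(2) by simp
qed (use assms(1) in simp)

text \<open>The generators satisfy the same relations as the sequence c. Two representations of one
  element are compared at level k + l, where their exponents agree modulo
  \<open>p ^ (k + l)\<close>, an exponent that kills \<open>c (k + l)\<close>.\<close>

lemma prufer_hom_exists:
  assumes p: "prime p"
    and c: "\<And>k. c k \<in> carrier G" "\<And>k. c (Suc k) [^] (p::nat) = c k" "c 0 = \<one>"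
  obtains h where "h \<in> hom (prufer_group p) G" "\<And>k i. h (prufer_gen p k ^ i) = c k [^] i"
proof -
  have p0: "p > 0" using p prime_gt_0_nat by blast
  note c_add = root_sequence_power[of c p, OF c(1,2)]
  have c_ord: "c k [^] (p ^ k) = \<one>" for k using c_add[of 0 k] c(3) by simp
  have c_cong: "c k [^] i = c k [^] j" if "[i = j] (mod p ^ k)" for i j k
  proof -
    have "c k [^] i = c k [^] (i mod p ^ k)" for i
    proof -
      have "c k [^] i = c k [^] (p ^ k * (i div p ^ k) + i mod p ^ k)" by simp
      also have "\<dots> = (c k [^] (p ^ k)) [^] (i div p ^ k) \<otimes> c k [^] (i mod p ^ k)"
        using c(1) by (simp only: nat_pow_mult nat_pow_pow nat_pow_closed)
      finally show ?thesis using c(1) by (simp add: c_ord)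
    qed
    then show ?thesis using that unfolding cong_def by metis
  qed
  have wd: "c k [^] i = c l [^] j" if "prufer_gen p k ^ i = prufer_gen p l ^ j" for k l i j
  proof -
    have "prufer_gen p (k + l) ^ (p ^ l * i) = prufer_gen p (k + l) ^ (p ^ k * j)"
      using that prufer_gen_power[OF p0, of k l] prufer_gen_power[OF p0, of l k]
      by (simp add: power_mult add.commute)
    then have "c (k + l) [^] (p ^ l * i) = c (k + l) [^] (p ^ k * j)"
      by (intro c_cong prufer_gen_power_eq[OF p0])
    moreover have "c (k + l) [^] (p ^ l * i) = c k [^] i"
      using c_add[of k l] c(1) by (metis nat_pow_pow)
    moreover have "c (k + l) [^] (p ^ k * j) = c l [^] j"
      using c_add[of l k] c(1) by (metis add.commute nat_pow_pow)
    ultimately show ?thesis by simp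
  qed
  \<comment> \<open>An element has many representations as a power of a generator; \<open>wd\<close>
    shows that the choice made here has no effect.\<close>
  define h where "h z = (SOME g. \<exists>k i. z = prufer_gen p k ^ i \<and> g = c k [^] i)" for z
  have h: "h (prufer_gen p k ^ i) = c k [^] i" for k i
    unfolding h_def by (rule some_equality, blast) (metis wd)
  have "h \<in> hom (prufer_group p) G"
  proof (rule homI)
    fix x assume "x \<in> carrier (prufer_group p)"
    then obtain k i where x: "x = prufer_gen p k ^ i" using prufer_carrier[OF p0] by blast
    then show "h x \<in> carrier G" using h c(1) by simp
    fix y assume "y \<in> carrier (prufer_group p)"
    then obtain l j where y: "y = prufer_gen p l ^ j" using prufer_carrier[OF p0] by blast
    have "h (x * y) = c (k + l) [^] (p ^ l * i + p ^ k * j)"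
      unfolding x y prufer_gen_mult[OF p0] h ..
    also have "\<dots> = (c (k + l) [^] (p ^ l)) [^] i \<otimes> (c (l + k) [^] (p ^ k)) [^] j"
      using c(1) by (simp add: nat_pow_mult nat_pow_pow add.commute)
    also have "\<dots> = h x \<otimes> h y" unfolding c_add x y h ..
    finally show "h (x \<otimes>\<^bsub>prufer_group p\<^esub> y) = h x \<otimes> h y" by simp
  qed
  then show ?thesis using h that by blast
qed

text \<open>Every nontrivial subgroup of a Pruefer group contains the elements of order p.
  Explicitly, let i be \<open>p ^ a * u\<close> with u prime to p and a < k; raising to the power
  \<open>p ^ (k - 1 - a) * v\<close>, where uv is 1 modulo p, yields \<open>c 1\<close>, which is
  not in H.\<close>

lemma prufer_hom_trivial_preimage:
  assumes p: "prime p"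
    and c: "\<And>k. c k \<in> carrier G" "\<And>k. c (Suc k) [^] (p::nat) = c k" "c 0 = \<one>"
    and H: "subgroup H G" "c 1 \<notin> H" and cH: "c k [^] i \<in> H"
  shows "prufer_gen p k ^ i = 1"
proof (cases "i = 0")
  case False
  have p0: "p > 0" using p prime_gt_0_nat by blast
  note c_add = root_sequence_power[of c p, OF c(1,2)]
  define a where "a = multiplicity p i"
  obtain u where u: "i = p ^ a * u" "\<not> p dvd u"
    unfolding a_def using multiplicity_decompose'[of i p] False p by (metis not_prime_unit)
  show ?thesis
  proof (cases "k \<le> a")
    case True
    then have "p ^ k dvd i" using u(1) by (simp add: le_imp_power_dvd)
    then obtain m where "i = p ^ k * m" ..
    then show ?thesis using prufer_gen_order[OF p0] by (simp add: power_mult)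
  next
    case False
    have "coprime u p" using u(2) p by (simp add: prime_imp_coprime coprime_commute)
    then obtain v where v: "[u * v = 1] (mod p)" using cong_solve_coprime_nat by auto
    have c1: "c 1 [^] p = \<one>" using c(2)[of 0] c(3) by simp
    have c1mod: "c 1 [^] m = c 1 [^] (m mod p)" for m
    proof -
      have "c 1 [^] m = c 1 [^] (p * (m div p) + m mod p)" by simp
      also have "\<dots> = (c 1 [^] p) [^] (m div p) \<otimes> c 1 [^] (m mod p)"
        using c(1) by (simp only: nat_pow_mult nat_pow_pow nat_pow_closed)
      finally show ?thesis unfolding c1 using c(1) by simp
    qed
    have "(c k [^] i) [^] (p ^ (k - 1 - a) * v) = c k [^] (p ^ (k - 1) * (u * v))"
    proof -
      have "p ^ a * p ^ (k - 1 - a) = p ^ (k - 1)" using False by (simp flip: power_add)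
      then have "i * (p ^ (k - 1 - a) * v) = p ^ (k - 1) * (u * v)" unfolding u(1)
        by (metis mult.assoc mult.left_commute)
      then show ?thesis using c(1) by (simp only: nat_pow_pow)
    qed
    also have "\<dots> = (c (1 + (k - 1)) [^] (p ^ (k - 1))) [^] (u * v)"
      using c(1) False by (simp add: nat_pow_pow)
    also have "\<dots> = c 1 [^] (u * v)" unfolding c_add ..
    also have "\<dots> = c 1 [^] (1::nat)" using c1mod v unfolding cong_def by metis
    finally have "c 1 = (c k [^] i) [^] (p ^ (k - 1 - a) * v)" using c(1) by simp
    also have "(c k [^] i) [^] m \<in> H" for m :: nat
      using subgroup.m_closed[OF H(1) _ cH] subgroup.one_closed[OF H(1)] by (induction m) auto
    finally show ?thesis using H(2) by simp
  qed
qed simp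

text \<open>A proper divisible subgroup H misses some x with trivial p-th power. Successive p-th
  roots of x give a homomorphism of a further Pruefer group, and no nontrivial element of that group
  is sent into H; so the new summand can be added while injectivity is kept.\<close>

lemma extend_prufer_sum:
  assumes p: "prime p"
    and tor: "\<And>x. x \<in> carrier G \<Longrightarrow> \<exists>k. x [^] ((p::nat) ^ k) = \<one>"
    and div: "\<And>x. x \<in> carrier G \<Longrightarrow> \<exists>y\<in>carrier G. y [^] p = x"
    and f: "f \<in> hom (prufer_sum p n) G"
    and inj: "inj_on f (carrier (prufer_sum p n))" and not_surj: "f ` carrier (prufer_sum p n) \<noteq> carrier G"
  obtains f' x where "f' \<in> hom (prufer_sum p (Suc n)) G"
    "inj_on f' (carrier (prufer_sum p (Suc n)))"
    "f ` carrier (prufer_sum p n) \<subseteq> f' ` carrier (prufer_sum p (Suc n))"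
    "x \<in> carrier G" "x [^] p = \<one>" "x \<notin> f ` carrier (prufer_sum p n)"
    "x \<in> f' ` carrier (prufer_sum p (Suc n))"
proof -
  let ?P = "prufer_group p" and ?S = "prufer_sum p n" and ?S' = "prufer_sum p (Suc n)"
  define H where "H = f ` carrier ?S"
  have p0: "p > 0" using p prime_gt_0_nat by blast
  have gP: "group ?P" by (rule group_prufer[OF p0])
  have gS: "group ?S" "group ?S'" using gP by simp_all
  note carS = carrier_prufer_sum[OF p0]
  interpret f: group_hom ?S G f using f gS by (simp add: group_hom_def group_hom_axioms_def)
  have H: "subgroup H G" unfolding H_def by (rule f.img_is_subgroup)
  have HG: "H \<subseteq> carrier G" using H subgroup.subset by blast
  \<comment> \<open>H inherits divisibility from the sum, where roots are taken
    coordinatewise.\<close>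
  have divH: "\<exists>y\<in>H. y [^] p = x" if "x \<in> H" for x
  proof -
    obtain s where s: "s \<in> carrier ?S" "x = f s" using \<open>x \<in> H\<close> unfolding H_def by blast
    have "\<exists>y. y \<in> carrier ?P \<and> y ^ p = s i" if "i < n" for i
      using prufer_divisible[OF p0, of "s i"] s(1) that unfolding carS by (metis PiE_mem lessThan_iff)
    then obtain t where t: "\<And>i. i < n \<Longrightarrow> t i \<in> carrier ?P \<and> t i ^ p = s i" by metis
    define t' where "t' = restrict t {..<n}"
    have t': "t' \<in> carrier ?S" unfolding carS t'_def using t by auto
    have pow: "t' [^]\<^bsub>?S\<^esub> m = (\<lambda>i\<in>{..<n}. t i ^ m)" for m :: nat
      by (induction m) (auto simp: t'_def fun_eq_iff)
    have "t' [^]\<^bsub>?S\<^esub> p = s" unfolding pow using t s(1) carS by (auto simp: fun_eq_iff PiE_def extensional_def)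
    then have "f t' [^] p = x" using s(2) f.hom_nat_pow[OF t'] by metis
    then show ?thesis using t' unfolding H_def by blast
  qed
  obtain g0 where g0: "g0 \<in> carrier G" "g0 \<notin> H" using not_surj HG unfolding H_def by blast
  \<comment> \<open>With k least, the power of g0 just before the k-th lies outside H while its own
    p-th power lies in H.\<close>
  define k where "k = (LEAST k. g0 [^] (p ^ k) \<in> H)"
  have "\<exists>k. g0 [^] (p ^ k) \<in> H" using tor[OF g0(1)] subgroup.one_closed[OF H] by metis
  then have k1: "g0 [^] (p ^ k) \<in> H" unfolding k_def by (rule LeastI_ex)
  have "k \<noteq> 0" using k1 g0 by (metis nat_pow_eone power_0)
  then obtain k' where k': "k = Suc k'" using not0_implies_Suc by blast
  define g where "g = g0 [^] (p ^ k')"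
  have g: "g \<in> carrier G" "g \<notin> H" "g [^] p \<in> H"
    using g0 k1 not_less_Least[of k' "\<lambda>k. g0 [^] (p ^ k) \<in> H"]
    unfolding g_def k_def[symmetric] k' by (auto simp: nat_pow_pow mult.commute)
  obtain d where d: "d \<in> H" "d [^] p = g [^] p" using divH g(3) by blast
  have dG: "d \<in> carrier G" using d HG by blast
  \<comment> \<open>d is a p-th root of \<open>g [^] p\<close> inside H; dividing by it kills the
    p-th power and stays outside H.\<close>
  define x where "x = g \<otimes> inv d"
  have x: "x \<in> carrier G" "x [^] p = \<one>"
    using g dG d(2) by (auto simp: x_def nat_pow_distrib nat_pow_inv)
  have "x \<notin> H"
  proof
    assume "x \<in> H"
    then have "x \<otimes> d \<in> H" using d(1) subgroup.m_closed[OF H] by blast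
    then show False using g dG by (simp add: x_def m_assoc)
  qed
  obtain r where r: "\<And>y. y \<in> carrier G \<Longrightarrow> r y \<in> carrier G \<and> r y [^] p = y" using div by metis
  \<comment> \<open>The sequence is 1, x, a root of x, and so on; the shift by one puts x at index
    1, the image of a generator of order p.\<close>
  define c where "c k = (case k of 0 \<Rightarrow> \<one> | Suc j \<Rightarrow> (r ^^ j) x)" for k
  have cr: "(r ^^ j) x \<in> carrier G" for j by (induction j) (use x r in auto)
  have c: "c k \<in> carrier G" "c (Suc k) [^] p = c k" "c 0 = \<one>" "c 1 = x" for k
    using cr x r by (auto simp: c_def split: nat.split)
  have "c 1 \<notin> H" using \<open>x \<notin> H\<close> c(4) by simp
  obtain h where h: "h \<in> hom ?P G" "\<And>k i. h (prufer_gen p k ^ i) = c k [^] i"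
    using prufer_hom_exists[OF p c(1,2,3)] by blast
  have hH: "z = 1" if z: "z \<in> carrier ?P" "h z \<in> H" for z
  proof -
    obtain k i where "z = prufer_gen p k ^ i" using z(1) prufer_carrier[OF p0] by blast
    then show ?thesis
      using prufer_hom_trivial_preimage[OF p c(1,2,3) H \<open>c 1 \<notin> H\<close>] z(2) h(2) by metis
  qed
  have h1: "h 1 = \<one>" using h(2)[of 0 0] by simp
  have hc: "h z \<in> carrier G" if "z \<in> carrier ?P" for z using that h(1) hom_in_carrier by fastforce
  define f' where "f' s = f (restrict s {..<n}) \<otimes> h (s n)" for s
  have res: "restrict s {..<n} \<in> carrier ?S" "s n \<in> carrier ?P" if "s \<in> carrier ?S'" for s
    using that unfolding carS by (simp_all add: PiE_iff)
  have f': "f' \<in> hom ?S' G"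
  proof (rule homI)
    fix s assume s: "s \<in> carrier ?S'"
    show "f' s \<in> carrier G" unfolding f'_def using res[OF s] hc by simp
    fix t assume t: "t \<in> carrier ?S'"
    have "restrict (s \<otimes>\<^bsub>?S'\<^esub> t) {..<n} = restrict s {..<n} \<otimes>\<^bsub>?S\<^esub> restrict t {..<n}"
      by (auto simp: fun_eq_iff)
    moreover have "(s \<otimes>\<^bsub>?S'\<^esub> t) n = s n \<otimes>\<^bsub>?P\<^esub> t n" by simp
    ultimately have "f' (s \<otimes>\<^bsub>?S'\<^esub> t) =
        (f (restrict s {..<n}) \<otimes> f (restrict t {..<n})) \<otimes> (h (s n) \<otimes> h (t n))"
      unfolding f'_def using f.hom_mult[OF res(1)[OF s] res(1)[OF t]] hom_mult[OF h(1) res(2)[OF s] res(2)[OF t]]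
      by (metis (no_types, lifting))
    also have "\<dots> = f' s \<otimes> f' t"
      unfolding f'_def using res[OF s] res[OF t] hc by (simp add: m_ac)
    finally show "f' (s \<otimes>\<^bsub>?S'\<^esub> t) = f' s \<otimes> f' t" .
  qed
  interpret f': group_hom ?S' G f' using f' gS by (simp add: group_hom_def group_hom_axioms_def)
  \<comment> \<open>For s in the kernel, h maps the last coordinate into H, so this coordinate is 1;
    the injectivity of f settles the others.\<close>
  have inj': "inj_on f' (carrier ?S')"
  proof (rule iffD2[OF f'.inj_on_one_iff], intro ballI allI impI)
    fix s assume s: "s \<in> carrier ?S'" and "f' s = \<one>"
    then have e: "f (restrict s {..<n}) \<otimes> h (s n) = \<one>" unfolding f'_def by simp
    have fc: "f (restrict s {..<n}) \<in> H" unfolding H_def using res(1)[OF s] by blast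
    then have "h (s n) = inv (f (restrict s {..<n}))"
      using e res[OF s] hc HG by (metis f.hom_closed inv_equality inv_inv)
    then have "h (s n) \<in> H" using fc subgroup.m_inv_closed[OF H] by simp
    then have sn: "s n = 1" using hH res(2)[OF s] by blast
    then have "f (restrict s {..<n}) = \<one>" using e h1 res(1)[OF s] by simp
    then have "restrict s {..<n} = \<one>\<^bsub>?S\<^esub>" using inj res(1)[OF s] f.inj_on_one_iff by blast
    then have "s i = 1" if "i < n" for i using that by (metis lessThan_iff one_sum_group prufer_simps(2) restrict_apply')
    then have "s i = 1" if "i < Suc n" for i using that sn less_Suc_eq by blast
    then show "s = \<one>\<^bsub>?S'\<^esub>" using s unfolding carS by (auto simp: fun_eq_iff PiE_def extensional_def)
  qed
  have oneP: "1 \<in> carrier ?P" by (simp add: prufer_group_def)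
  have sub: "H \<subseteq> f' ` carrier ?S'"
  proof
    fix y assume "y \<in> H"
    then obtain s where s: "s \<in> carrier ?S" "y = f s" unfolding H_def by blast
    define t where "t = (\<lambda>i\<in>{..<Suc n}. if i < n then s i else 1)"
    have si: "s i \<in> carrier ?P" if "i < n" for i
      using s(1) that unfolding carS by (metis PiE_mem lessThan_iff)
    have "t \<in> carrier ?S'" unfolding carS t_def restrict_PiE_iff using si oneP by simp
    moreover have "restrict t {..<n} = s"
    proof
      fix i show "restrict t {..<n} i = s i"
        using PiE_arb[OF s(1)[unfolded carS], of i] by (cases "i < n") (simp_all add: t_def)
    qed
    moreover have "t n = 1" by (simp add: t_def)
    ultimately have "f' t = y" unfolding f'_def using h1 s by simp
    then show "y \<in> f' ` carrier ?S'" using \<open>t \<in> carrier ?S'\<close> by blast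
  qed
  have xin: "x \<in> f' ` carrier ?S'"
  proof
    define t where "t = (\<lambda>i\<in>{..<Suc n}. if i < n then 1 else prufer_gen p 1)"
    have "prufer_gen p 1 \<in> carrier ?P" using prufer_carrier[OF p0] by (metis power_one_right)
    then show "t \<in> carrier ?S'" unfolding carS t_def restrict_PiE_iff using oneP by simp
    have "restrict t {..<n} = \<one>\<^bsub>?S\<^esub>" unfolding t_def by (auto simp: fun_eq_iff)
    then have "f (restrict t {..<n}) = \<one>" using f.hom_one by simp
    moreover have "h (t n) = x" using h(2)[of 1 1] c(4) x(1) by (simp add: t_def)
    ultimately show "x = f' t" unfolding f'_def using x(1) by simp
  qed
  show ?thesis
    by (rule that[OF f' inj' sub[unfolded H_def] x]) (use \<open>x \<notin> H\<close> xin H_def in auto)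
qed

text \<open>Induction on the number of elements with trivial p-th power outside the image. The socle
  is finite and each extension captures a new element of it, so the process ends, and it can only
  end with a surjective map.\<close>

lemma divisible_p_group_prufer_sum:
  assumes p: "prime p"
    and tor: "\<And>x. x \<in> carrier G \<Longrightarrow> \<exists>k. x [^] ((p::nat) ^ k) = \<one>"
    and div: "\<And>x. x \<in> carrier G \<Longrightarrow> \<exists>y\<in>carrier G. y [^] p = x"
    and fin: "finite {x \<in> carrier G. x [^] p = \<one>}" and nontriv: "carrier G \<noteq> {\<one>}"
  shows "finite_sum_of_prufer_groups p G"
proof -
  let ?S = "prufer_sum p"
  have p0: "p > 0" using p prime_gt_0_nat by blast
  have gS: "group (?S n)" for n using group_prufer[OF p0] by simp
  have *: "\<exists>n f. f \<in> iso (?S n) G"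
    if "f \<in> hom (?S n) G" "inj_on f (carrier (?S n))"
       "card ({x \<in> carrier G. x [^] p = \<one>} - f ` carrier (?S n)) = m" for m n f
    using that
  proof (induction m arbitrary: n f rule: less_induct)
    case (less m)
    show ?case
    proof (cases "f ` carrier (?S n) = carrier G")
      case True
      then show ?thesis using less.prems unfolding iso_def bij_betw_def by blast
    next
      case False
      from extend_prufer_sum[OF p tor div less.prems(1,2) False] obtain f' x where f':
        "f' \<in> hom (?S (Suc n)) G" "inj_on f' (carrier (?S (Suc n)))"
        "f ` carrier (?S n) \<subseteq> f' ` carrier (?S (Suc n))"
        "x \<in> carrier G" "x [^] p = \<one>" "x \<notin> f ` carrier (?S n)" "x \<in> f' ` carrier (?S (Suc n))"
        by metis
      have "{x \<in> carrier G. x [^] p = \<one>} - f' ` carrier (?S (Suc n)) \<subset>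
          {x \<in> carrier G. x [^] p = \<one>} - f ` carrier (?S n)"
        using f' by blast
      then have "card ({x \<in> carrier G. x [^] p = \<one>} - f' ` carrier (?S (Suc n))) < m"
        unfolding less.prems(3)[symmetric] using fin by (intro psubset_card_mono) simp_all
      then show ?thesis using less.IH f'(1,2) by blast
    qed
  qed
  \<comment> \<open>The start is the empty sum, whose only element is the function that is
    \<open>undefined\<close> everywhere.\<close>
  have "(\<lambda>_. \<one>) \<in> hom (?S 0) G" by (rule homI) auto
  moreover have "inj_on (\<lambda>_. \<one>) (carrier (?S 0))"
    unfolding carrier_prufer_sum[OF p0] by (simp add: inj_on_def)
  ultimately obtain n f where f: "f \<in> iso (?S n) G" using * by blast
  have "n > 0"
  proof (rule ccontr)
    assume "\<not> n > 0"
    then have "n = 0" by simp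
    have "carrier G = f ` carrier (?S n)" using f unfolding iso_def bij_betw_def by blast
    then have "carrier G = {f (\<lambda>_. undefined)}" unfolding carrier_prufer_sum[OF p0] \<open>n = 0\<close> by simp
    then show False using nontriv one_closed by auto
  qed
  moreover have "G \<cong> ?S n" using group.iso_sym[OF gS is_isoI[OF f]] .
  ultimately show ?thesis unfolding finite_sum_of_prufer_groups_def by blast
qed

end


section \<open>The classification\<close>

theorem theorem2:
  fixes L :: "('f, 'r) lang"
    and M Mbar :: "('f, 'r, 'a) struct"
    and \<kappa> :: "'k rel"
    and G :: "('a, 'm) monoid_scheme"
  assumes "minimal_group L M G"
    and "monster L \<kappa> M Mbar"
    and "almost_linear L M Mbar"
  shows "(\<exists>p::nat. prime p \<and> (elementary_abelian p G \<or> finite_sum_of_prufer_groups p G))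
    \<and> torsion_group G"
proof -
  have "group G" using assms(1) unfolding minimal_group_def by simp
  then interpret min_group G L M
    using assms(1) by (simp add: min_group_def min_group_axioms_def)
  interpret comm_group G by (rule is_comm_group)
  interpret min_comm_group G L M ..
  obtain \<phi> where \<phi>: "almost_linear_order L M Mbar \<phi>"
    using assms(3) unfolding almost_linear_def by blast
  let ?R = "rel_of M \<phi>"
  obtain F where F: "finite F" "F \<subseteq> univ M"
    "\<And>x y z. x \<in> univ M - F \<Longrightarrow> y \<in> univ M - F \<Longrightarrow> z \<in> univ M - F \<Longrightarrow>
       incomparability ?R x y \<Longrightarrow> incomparability ?R y z \<Longrightarrow> incomparability ?R x z"
    using almost_linear_cofinite[OF minimal_M assms(2) \<phi>] by metis
  have "\<phi> \<in> fm2 L (carrier G)" "strict_partial_order_on (carrier G) ?R"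
    "has_infinite_chain (carrier G) ?R"
    using \<phi> unfolding almost_linear_order_def univ_eq by blast+
  \<comment> \<open>From here on the monster model is left behind: the preorder lives on the group
    itself.\<close>
  from preord_of_almost_linear[OF rel_of_dfn[OF this(1)] this(2,3) F[unfolded univ_eq]]
  have pre: "preord (\<lambda>x y. x \<in> F \<or> y \<notin> F \<and> \<not> ?R y x)" .
  have nontriv: "carrier G \<noteq> {\<one>\<^bsub>G\<^esub>}" using infinite_carrier by auto
  show ?thesis
  proof (rule exponent_or_single_prime[OF pre])
    fix p :: nat assume p: "prime p" and exp: "\<And>x. x \<in> carrier G \<Longrightarrow> x [^]\<^bsub>G\<^esub> p = \<one>\<^bsub>G\<^esub>"
    have "ord x = p" if "x \<in> carrier G" "x \<noteq> \<one>\<^bsub>G\<^esub>" for x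
      using pow_eq_id[OF that(1), of p] exp[OF that(1)] ord_eq_1[OF that(1)] that(2) p
      by (metis prime_nat_iff)
    then have "elementary_abelian p G"
      using nontriv comm_group_axioms unfolding elementary_abelian_def by blast
    moreover have "torsion_group G"
      using exp prime_gt_0_nat[OF p] unfolding torsion_group_def by blast
    ultimately show ?thesis using p by blast
  next
    fix p :: nat assume p: "prime p"
      and tor: "\<And>x. x \<in> carrier G \<Longrightarrow> \<exists>k. x [^]\<^bsub>G\<^esub> (p ^ k) = \<one>\<^bsub>G\<^esub>"
      and div: "\<And>x. x \<in> carrier G \<Longrightarrow> \<exists>y\<in>carrier G. y [^]\<^bsub>G\<^esub> p = x"
      and fin: "finite {x \<in> carrier G. x [^]\<^bsub>G\<^esub> p = \<one>\<^bsub>G\<^esub>}"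
    have "finite_sum_of_prufer_groups p G"
      using p tor div fin nontriv by (rule divisible_p_group_prufer_sum)
    moreover have "p ^ k > 0" for k using prime_gt_0_nat[OF p] by simp
    then have "torsion_group G" using tor unfolding torsion_group_def by blast
    ultimately show ?thesis using p by blast
  qed
qed

end
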